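(* Let $0<\delta<1$, $0<\beta<1$, and $k=\lfloor \beta n\rfloor$. Then for all $n$ sufficiently large (depending on $\beta$ and $\delta$), with probability at least $1-\delta$ over the sample, $$\sup_{x\in\mathcal{X}} |\eta_k(x)-\widetilde{\eta}_\beta(x)| \;\le\; 3\sqrt{\frac{2\log(4D/\delta)+2D\log(n)}{\beta\cdot n}}.$$
   Context: Standing setting (binary classification): $\mathcal{X}\subseteq\mathbb{R}^D$ is compact; $p_X$ is a probability density on $\mathcal{X}$ with distribution $\mathcal{P}$; $\eta:\mathcal{X}\to[0,1]$ is the label function. The sample $(x_1,y_1),\dots,(x_n,y_n)$ is i.i.d.: $x_i\sim p_X$ and $y_i\in\{0,1\}$ with $\mathbb{P}(y_i=1\mid x_i=x)=\eta(x)$. Write $X:=\{x_1,\dots,x_n\}$ and $B(x,r):=\{x'\in\mathcal{X}: |x-x'|\le r\}$ (Euclidean norm). The $k$-NN radius is $r_k(x):=\inf\{r: |B(x,r)\cap X|\ge k\}$, the $k$-NN set is $N_k(x):=B(x,r_k(x))\cap X$, and the $k$-NN label is $\eta_k(x):=\frac{1}{|N_k(x)|}\sum_{i=1}^n y_i\,\mathbf{1}[x_i\in N_k(x)]$. $\beta$-smoothed label function: $r_\beta(x):=\inf\{r>0: \mathcal{P}(B(x,r))\ge\beta\}$, and $\widetilde{\eta}_\beta(x):=\frac{1}{\beta}\int_{B(x,r_\beta(x))}\eta(x')\,p_X(x')\,dx'$. *)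

theory Defs
  imports "HOL-Probability.Probability"
begin

definition Bx :: "'a::euclidean_space set \<Rightarrow> 'a \<Rightarrow> real \<Rightarrow> 'a set" where
  "Bx Xs x r = {x' \<in> Xs. dist x x' \<le> r}"

definition Pdist :: "'a::euclidean_space set \<Rightarrow> ('a \<Rightarrow> real) \<Rightarrow> 'a set \<Rightarrow> real" where
  "Pdist Xs p A = (LINT x:(A \<inter> Xs)|lborel. p x)"

text \<open>Joint distribution of one labelled sample point (x,y): x has density p on Xs,
  and P(y = True | x) = eta x (label 1 encoded as True).\<close>
definition sample_dist ::
  "'a::euclidean_space set \<Rightarrow> ('a \<Rightarrow> real) \<Rightarrow> ('a \<Rightarrow> real) \<Rightarrow> ('a \<times> bool) measure" where
  "sample_dist Xs p eta = density (lborel \<Otimes>\<^sub>M count_space UNIV)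
     (\<lambda>(x, b). ennreal (indicator Xs x * p x * (if b then eta x else 1 - eta x)))"

definition sample_space ::
  "nat \<Rightarrow> 'a::euclidean_space set \<Rightarrow> ('a \<Rightarrow> real) \<Rightarrow> ('a \<Rightarrow> real) \<Rightarrow> (nat \<Rightarrow> 'a \<times> bool) measure" where
  "sample_space n Xs p eta = PiM {..<n} (\<lambda>_. sample_dist Xs p eta)"

text \<open>k-NN radius r_k(x) = inf {r. |B(x,r) \<inter> X| \<ge> k} (points counted with multiplicity).\<close>
definition knn_radius ::
  "nat \<Rightarrow> 'a::euclidean_space set \<Rightarrow> (nat \<Rightarrow> 'a \<times> bool) \<Rightarrow> nat \<Rightarrow> 'a \<Rightarrow> real" where
  "knn_radius n Xs S k x = Inf {r. card {i \<in> {..<n}. fst (S i) \<in> Bx Xs x r} \<ge> k}"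

definition knn_set ::
  "nat \<Rightarrow> 'a::euclidean_space set \<Rightarrow> (nat \<Rightarrow> 'a \<times> bool) \<Rightarrow> nat \<Rightarrow> 'a \<Rightarrow> nat set" where
  "knn_set n Xs S k x = {i \<in> {..<n}. fst (S i) \<in> Bx Xs x (knn_radius n Xs S k x)}"

definition knn_label ::
  "nat \<Rightarrow> 'a::euclidean_space set \<Rightarrow> (nat \<Rightarrow> 'a \<times> bool) \<Rightarrow> nat \<Rightarrow> 'a \<Rightarrow> real" where
  "knn_label n Xs S k x =
     (\<Sum>i\<in>knn_set n Xs S k x. (if snd (S i) then 1 else 0)) / real (card (knn_set n Xs S k x))"

definition beta_radius ::
  "'a::euclidean_space set \<Rightarrow> ('a \<Rightarrow> real) \<Rightarrow> real \<Rightarrow> 'a \<Rightarrow> real" where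
  "beta_radius Xs p \<beta> x = Inf {r. r > 0 \<and> Pdist Xs p (Bx Xs x r) \<ge> \<beta>}"

definition smoothed_label ::
  "'a::euclidean_space set \<Rightarrow> ('a \<Rightarrow> real) \<Rightarrow> ('a \<Rightarrow> real) \<Rightarrow> real \<Rightarrow> 'a \<Rightarrow> real" where
  "smoothed_label Xs p eta \<beta> x =
     (1 / \<beta>) * (LINT x':(Bx Xs x (beta_radius Xs p \<beta> x))|lborel. eta x' * p x')"

end

theory Submission
  imports Defs "HOL-Probability.Hoeffding" "HOL-Real_Asymp.Real_Asymp"
begin

text \<open>
  Fix \<open>x\<close> and let \<open>B\<close> be the ball around \<open>x\<close> of mass exactly \<open>\<beta>\<close>. The \<open>k\<close>-NN ball and \<open>B\<close> are
  concentric. If the \<open>k\<close>-NN ball is the smaller one, its number of points with label \<open>b\<close> is at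
  most that of \<open>B\<close>; if it is the larger one, its number of points with label \<open>\<not> b\<close> is at least
  that of \<open>B\<close>, while it contains at most \<open>k\<close> points plus those on its bounding sphere. So only the
  counts of labelled points in balls of mass about \<open>\<beta>\<close>, and the counts in thin shells (ties),
  have to be controlled uniformly; both reduce to countable families of balls.

  Uniformity comes from symmetrisation with a ghost sample. Given the double sample, the
  difference of the two counts of a set is a Rademacher sum whose variance proxy is the total
  count, so a union bound over the traces costs only the logarithm of their number. By
  Sauer--Shelah and Radon's theorem on the paraboloid there are at most \<open>(2n + 1)\<^bsup>D + 2\<^esup>\<close> traces
  of balls. This gives the rate \<open>sqrt (4 (D + 2) ln n / (\<beta> n))\<close> up to lower order terms, and
  \<open>4 (D + 2) < 18 D\<close>.
\<close>

subsection \<open>Sign sums\<close>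

text \<open>Hoeffding's lemma for a symmetric two-point distribution: its analytic core at
  \<open>p = 1/2\<close>, \<open>h = 2 * x\<close> gives the bound for \<open>x \<ge> 0\<close>, and
  both sides are even in \<open>x\<close>.\<close>

lemma cosh_le_exp_half_square:
  fixes x :: real
  shows "exp x + exp (- x) \<le> 2 * exp (x\<^sup>2 / 2)"
proof -
  have *: "exp x + exp (- x) \<le> 2 * exp (x\<^sup>2 / 2)" if "x \<ge> 0" for x :: real
  proof -
    have "- x + ln ((1 + exp (2 * x)) / 2) \<le> x\<^sup>2 / 2"
      using Hoeffdings_lemma_aux[of "2 * x" "1/2"] that by (simp add: field_simps power2_eq_square)
    hence "exp (ln ((1 + exp (2 * x)) / 2)) \<le> exp (x + x\<^sup>2 / 2)"
      by simp
    hence "(1 + exp (2 * x)) \<le> 2 * exp (x\<^sup>2 / 2) * exp x"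
      by (simp add: add_pos_pos exp_add mult_ac)
    moreover have "1 + exp (2 * x) = (exp x + exp (-x)) * exp x"
      by (simp add: algebra_simps flip: exp_add)
    ultimately show ?thesis
      by simp
  qed
  show ?thesis
    using *[of x] *[of "- x"] by (cases "x \<ge> 0") auto
qed

text \<open>Chernoff bound for a Rademacher sum in counting form: \<open>X\<close> is the set of
  indices with sign plus, so division by \<open>2 ^ card I\<close> turns the count into a
  probability. Counting suits the later use, where the double sample is fixed and only the swaps
  vary.\<close>

lemma card_sign_sum_gt:
  fixes a :: "'i \<Rightarrow> real"
  assumes I: "finite I" and V: "(\<Sum>i\<in>I. (a i)\<^sup>2) \<le> V" and L: "0 < L"
  shows "card {X \<in> Pow I. sqrt (2 * L * V) < sum a X - sum a (I - X)} \<le> exp (- L) * 2 ^ card I"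
\<comment> \<open>The exponent \<open>l\<close> below divides by \<open>V\<close>. For
  \<open>V = 0\<close> all \<open>a i\<close> vanish, and the event is empty because its inequality
  is strict.\<close>
proof (cases "V = 0")
  case True
  hence "(\<Sum>i\<in>I. (a i)\<^sup>2) = 0"
    using V by (meson antisym sum_nonneg zero_le_power2)
  hence "a i = 0" if "i \<in> I" for i
    using that I by (simp add: sum_nonneg_eq_0_iff)
  hence "\<not> sqrt (2 * L * V) < sum a X - sum a (I - X)" if "X \<subseteq> I" for X
    using that True by (simp add: subset_eq)
  hence empty: "{X \<in> Pow I. sqrt (2 * L * V) < sum a X - sum a (I - X)} = {}"
    by blast
  show ?thesis unfolding empty by simp
next
  case False
  moreover have "V \<ge> 0"
    using V by (smt (verit) sum_nonneg zero_le_power2)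
  ultimately have Vp: "V > 0" by simp
  \<comment> \<open>The minimiser of \<open>l\<^sup>2 * V / 2 - l * sqrt (2 * L * V)\<close>; at
    this value the two terms are \<open>L\<close> and \<open>2 * L\<close>.\<close>
  define l where "l = sqrt (2 * L / V)"
  have l: "l > 0" "l\<^sup>2 = 2 * L / V"
    using Vp L by (auto simp: l_def)
  have l2: "l * sqrt (2 * L * V) = 2 * L"
  proof -
    have "l * sqrt (2 * L * V) = sqrt ((2 * L)\<^sup>2)"
      using Vp by (simp add: l_def power2_eq_square flip: real_sqrt_mult)
    also have "\<dots> = 2 * L" using L by (simp only: real_sqrt_abs)
    finally show ?thesis .
  qed
  let ?S = "{X \<in> Pow I. sqrt (2 * L * V) < sum a X - sum a (I - X)}"
  have "card ?S * exp (2 * L) = (\<Sum>X\<in>?S. exp (2 * L))" by simp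
  also have "\<dots> \<le> (\<Sum>X\<in>?S. exp (l * (sum a X - sum a (I - X))))"
  proof (rule sum_mono)
    fix X assume "X \<in> ?S"
    hence "l * sqrt (2 * L * V) \<le> l * (sum a X - sum a (I - X))"
      using l by (intro mult_left_mono) auto
    thus "exp (2 * L) \<le> exp (l * (sum a X - sum a (I - X)))"
      using l2 by simp
  qed
  also have "\<dots> \<le> (\<Sum>X\<in>Pow I. exp (l * (sum a X - sum a (I - X))))"
    using I by (intro sum_mono2) auto
  also have "\<dots> = (\<Sum>X\<in>Pow I. (\<Prod>i\<in>X. exp (l * a i)) * (\<Prod>i\<in>I - X. exp (- (l * a i))))"
    using I by (intro sum.cong)
      (auto simp: exp_sum[symmetric] finite_subset exp_add[symmetric] sum_distrib_left
        sum_negf right_diff_distrib)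
  \<comment> \<open>Independence of the signs: the sum over all sign patterns factorises.\<close>
  also have "\<dots> = (\<Prod>i\<in>I. exp (l * a i) + exp (- (l * a i)))"
    using I by (rule prod_add[symmetric])
  also have "\<dots> \<le> (\<Prod>i\<in>I. 2 * exp ((l * a i)\<^sup>2 / 2))"
    by (intro prod_mono) (auto simp: cosh_le_exp_half_square add_nonneg_nonneg)
  also have "\<dots> = 2 ^ card I * exp (l\<^sup>2 / 2 * (\<Sum>i\<in>I. (a i)\<^sup>2))"
    using I by (simp add: prod.distrib exp_sum[symmetric] sum_distrib_left power_mult_distrib)
  also have "\<dots> \<le> 2 ^ card I * exp (l\<^sup>2 / 2 * V)"
    using V by (simp add: mult_left_mono)
  also have "\<dots> = 2 ^ card I * exp L"
    using Vp l by simp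
  finally have le: "card ?S * exp (2 * L) \<le> 2 ^ card I * exp L" .
  have "real (card ?S) = card ?S * exp (2 * L) * exp (- 2 * L)"
    by (simp add: mult.assoc flip: exp_add)
  also have "\<dots> \<le> 2 ^ card I * exp L * exp (- 2 * L)"
    by (intro mult_right_mono le) auto
  also have "\<dots> = exp (- L) * 2 ^ card I"
    by (simp add: mult.assoc flip: exp_add)
  finally show ?thesis .
qed

lemma card_abs_sign_sum_gt:
  fixes a :: "'i \<Rightarrow> real"
  assumes I: "finite I" and V: "(\<Sum>i\<in>I. (a i)\<^sup>2) \<le> V" and L: "0 < L"
  shows "card {X \<in> Pow I. sqrt (2 * L * V) < \<bar>sum a X - sum a (I - X)\<bar>} \<le> 2 * exp (- L) * 2 ^ card I"
proof -
  let ?S = "\<lambda>a. {X \<in> Pow I. sqrt (2 * L * V) < sum a X - sum a (I - X)}"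
  have "{X \<in> Pow I. sqrt (2 * L * V) < \<bar>sum a X - sum a (I - X)\<bar>} = ?S a \<union> ?S (\<lambda>i. - a i)"
    by (auto simp: sum_negf abs_if)
  hence "card {X \<in> Pow I. sqrt (2 * L * V) < \<bar>sum a X - sum a (I - X)\<bar>} \<le> card (?S a) + card (?S (\<lambda>i. - a i))"
    by (simp only: card_Un_le)
  hence "real (card {X \<in> Pow I. sqrt (2 * L * V) < \<bar>sum a X - sum a (I - X)\<bar>})
      \<le> real (card (?S a)) + real (card (?S (\<lambda>i. - a i)))"
    by (simp only: of_nat_le_iff flip: of_nat_add)
  also have "\<dots> \<le> exp (- L) * 2 ^ card I + exp (- L) * 2 ^ card I"
    using assms by (intro add_mono card_sign_sum_gt) auto
  finally show ?thesis by simp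
qed

subsection \<open>Traces of balls\<close>

definition shattered :: "'i set set \<Rightarrow> 'i set set" where
  "shattered F = {J. \<forall>T\<subseteq>J. \<exists>A\<in>F. A \<inter> J = T}"

lemma shattered_subset: "F \<subseteq> Pow U \<Longrightarrow> shattered F \<subseteq> Pow U"
  by (fastforce simp: shattered_def)

text \<open>Pajor's form of the Sauer--Shelah lemma, free of any dimension. Removing
  \<open>u\<close> splits \<open>F\<close> into \<open>F0\<close> and \<open>F1\<close>. A set
  shattered by either of them is shattered by \<open>F\<close>, and one shattered by both remains
  shattered after adding \<open>u\<close>, so it is rightly counted twice.\<close>

lemma card_le_card_shattered:
  assumes "finite U" "F \<subseteq> Pow U"
  shows "card F \<le> card (shattered F)"
  using assms
proof (induction U arbitrary: F rule: finite_induct)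
  case empty
  hence "F = {} \<or> F = {{}}" by auto
  thus ?case
  proof
    assume "F = {{}}"
    moreover from this have "shattered F = {{}}" by (auto simp: shattered_def)
    ultimately show ?thesis by simp
  qed simp
next
  case (insert u U)
  define F0 where "F0 = {A \<in> F. u \<notin> A}"
  define F1 where "F1 = (\<lambda>A. A - {u}) ` {A \<in> F. u \<in> A}"
  have sub: "F0 \<subseteq> Pow U" "F1 \<subseteq> Pow U"
    using insert.prems by (auto simp: F0_def F1_def)
  have fin: "finite F" "finite (shattered F)" "finite (shattered F0)" "finite (shattered F1)"
    using insert.prems insert.hyps sub
    by (meson finite_Pow_iff finite_insert finite_subset shattered_subset)+
  have "card F = card (F0 \<union> {A \<in> F. u \<in> A})"
    by (rule arg_cong[of _ _ card]) (auto simp: F0_def)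
  also have "\<dots> = card F0 + card {A \<in> F. u \<in> A}"
    using fin by (intro card_Un_disjoint) (auto simp: F0_def)
  also have "card {A \<in> F. u \<in> A} = card F1"
    unfolding F1_def by (intro card_image[symmetric] inj_onI) auto
  also have "card F0 + card F1 \<le> card (shattered F0) + card (shattered F1)"
    using insert.IH sub by (intro add_mono) auto
  also have "\<dots> = card (shattered F0 \<union> shattered F1) + card (shattered F0 \<inter> shattered F1)"
    using fin by (intro card_Un_Int)
  also have "card (shattered F0 \<inter> shattered F1) = card (insert u ` (shattered F0 \<inter> shattered F1))"
  proof (intro card_image[symmetric] inj_onI)
    fix J K assume "J \<in> shattered F0 \<inter> shattered F1" "K \<in> shattered F0 \<inter> shattered F1"
      and eq: "insert u J = insert u K"
    hence "u \<notin> J" "u \<notin> K" using shattered_subset[OF sub(1)] \<open>u \<notin> U\<close> by auto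
    thus "J = K" using eq by (simp add: insert_ident)
  qed
  also have "card (shattered F0 \<union> shattered F1) + \<dots> =
      card ((shattered F0 \<union> shattered F1) \<union> insert u ` (shattered F0 \<inter> shattered F1))"
    using shattered_subset[OF sub(1)] shattered_subset[OF sub(2)] \<open>u \<notin> U\<close> fin
    by (intro card_Un_disjoint[symmetric]) auto
  also have "\<dots> \<le> card (shattered F)"
  proof (rule card_mono)
    have F1D: "\<exists>B\<in>F. u \<in> B \<and> A = B - {u}" if "A \<in> F1" for A
      using that by (auto simp: F1_def)
    have nJ: "u \<notin> J" if "J \<in> shattered F0 \<or> J \<in> shattered F1" for J
      using that shattered_subset[OF sub(1)] shattered_subset[OF sub(2)] \<open>u \<notin> U\<close> by auto
    show "shattered F0 \<union> shattered F1 \<union> insert u ` (shattered F0 \<inter> shattered F1) \<subseteq> shattered F"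
    proof
      fix J assume "J \<in> shattered F0 \<union> shattered F1 \<union> insert u ` (shattered F0 \<inter> shattered F1)"
      then consider "J \<in> shattered F0" | "J \<in> shattered F1"
        | K where "J = insert u K" "K \<in> shattered F0" "K \<in> shattered F1" by auto
      thus "J \<in> shattered F"
      proof cases
        case 1
        thus ?thesis by (auto simp: shattered_def F0_def)
      next
        case 2
        show ?thesis unfolding shattered_def
        proof safe
          fix T assume "T \<subseteq> J"
          then obtain A where A: "A \<in> F1" "A \<inter> J = T" using 2 by (auto simp: shattered_def)
          obtain B where "B \<in> F" "u \<in> B" "A = B - {u}" using F1D[OF A(1)] by auto
          moreover have "u \<notin> J" using nJ 2 by auto
          ultimately show "\<exists>A\<in>F. A \<inter> J = T" using A(2) by (intro bexI[of _ B]) auto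
        qed
      next
        case 3
        have u: "u \<notin> K" using 3 nJ by auto
        show ?thesis unfolding shattered_def
        proof safe
          fix T assume T: "T \<subseteq> J"
          show "\<exists>A\<in>F. A \<inter> J = T"
          proof (cases "u \<in> T")
            case True
            have "T - {u} \<subseteq> K" using T 3 by auto
            then obtain A where A: "A \<in> F1" "A \<inter> K = T - {u}" using 3 unfolding shattered_def by blast
            obtain B where "B \<in> F" "u \<in> B" "A = B - {u}" using F1D[OF A(1)] by auto
            thus ?thesis using A(2) u True 3(1) by (intro bexI[of _ B]) auto
          next
            case False
            hence "T \<subseteq> K" using T 3 by auto
            then obtain A where "A \<in> F0" "A \<inter> K = T" using 3 unfolding shattered_def by blast
            thus ?thesis using u False 3(1) by (intro bexI[of _ A]) (auto simp: F0_def)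
          qed
        qed
      qed
    qed
  qed fact
  finally show ?case .
qed

text \<open>A crude polynomial bound suffices: only the exponent \<open>d\<close> enters the leading
  constant of the rate.\<close>

lemma card_bounded_subsets_le:
  "finite {J. J \<subseteq> {..<m::nat} \<and> card J \<le> d} \<and> card {J. J \<subseteq> {..<m::nat} \<and> card J \<le> d} \<le> (m + 1) ^ d"
proof (induction d)
  case 0
  have "{J. J \<subseteq> {..<m::nat} \<and> card J \<le> 0} = {{}}"
    using finite_subset by fastforce
  thus ?case by simp
next
  case (Suc d)
  let ?S = "\<lambda>d. {J. J \<subseteq> {..<m::nat} \<and> card J \<le> d}"
  \<comment> \<open>The extra value \<open>m\<close> stands for adding no element; it covers the
    sets that already have at most \<open>d\<close> elements.\<close>
  let ?h = "\<lambda>(x, J). if x < m then insert x J else J"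
  have sub: "?S (Suc d) \<subseteq> ?h ` ({..m} \<times> ?S d)"
  proof
    fix J assume J: "J \<in> ?S (Suc d)"
    show "J \<in> ?h ` ({..m} \<times> ?S d)"
    proof (cases "card J \<le> d")
      case True
      thus ?thesis using J by (intro image_eqI[of _ _ "(m, J)"]) auto
    next
      case False
      hence "J \<noteq> {}" by auto
      then obtain x where x: "x \<in> J" by auto
      have "finite J" using J finite_subset by auto
      thus ?thesis using J x by (intro image_eqI[of _ _ "(x, J - {x})"]) auto
    qed
  qed
  have fin: "finite ({..m} \<times> ?S d)" using Suc by auto
  have "card (?S (Suc d)) \<le> card ({..m} \<times> ?S d)"
    using surj_card_le[OF fin sub] .
  also have "\<dots> \<le> (m + 1) * (m + 1) ^ d"
    using Suc by (simp only: card_cartesian_product card_atMost Suc_eq_plus1 mult_left_mono)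
  finally show ?case using finite_subset[OF sub] fin by auto
qed

text \<open>Mapping \<open>y\<close> to \<open>(y, y \<bullet> y)\<close> lifts the points into
  dimension \<open>DIM('a) + 1\<close>, where \<open>DIM('a) + 3\<close> points admit a Radon
  partition. A ball cutting out one part would separate the two convex hulls by a hyperplane, yet
  these hulls meet.\<close>

lemma ball_shattered_card_le:
  fixes z :: "nat \<Rightarrow> 'a::euclidean_space"
  assumes J: "finite J" "\<forall>T\<subseteq>J. \<exists>c r. {i \<in> J. dist c (z i) \<le> r} = T"
  shows "card J \<le> DIM('a) + 2"
proof (rule ccontr)
  assume "\<not> card J \<le> DIM('a) + 2"
  define w where "w = (\<lambda>i. (z i, z i \<bullet> z i))"
  \<comment> \<open>The points \<open>z i\<close> may coincide a priori, but then no ball could cut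
    out one of the two indices alone.\<close>
  have inj: "inj_on w J"
  proof (rule inj_onI, rule ccontr)
    fix i j assume ij: "i \<in> J" "j \<in> J" "w i = w j" "i \<noteq> j"
    then obtain c r where "{i \<in> J. dist c (z i) \<le> r} = {i}" using J by (meson empty_subsetI insert_subset)
    moreover have "z i = z j" using ij by (simp add: w_def)
    ultimately show False using ij by (metis (mono_tags, lifting) mem_Collect_eq singleton_iff)
  qed
  have dep: "affine_dependent (w ` J)"
    using J \<open>\<not> _\<close> by (intro affine_dependent_biggerset) (auto simp: card_image[OF inj])
  obtain M P where MP: "M \<inter> P = {}" "M \<union> P = w ` J" "convex hull M \<inter> convex hull P \<noteq> {}"
    using Radon_partition[OF finite_imageI[OF J(1)] dep] by blast
  define T where "T = {i \<in> J. w i \<in> M}"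
  obtain c r where cr: "{i \<in> J. dist c (z i) \<le> r} = T"
    using J(2)[rule_format, of T] unfolding T_def by blast
  have w_iff: "w i \<in> M \<longleftrightarrow> dist c (z i) \<le> r" if "i \<in> J" for i
    using cr that by (auto simp: T_def)
  show False
  \<comment> \<open>Squaring the radius, as in \<open>half\<close> below, needs
    \<open>r \<ge> 0\<close>. For \<open>r < 0\<close> the ball is empty, and an empty part has an
    empty hull.\<close>
  proof (cases "r < 0")
    case True
    hence "M = {}" using w_iff MP(2) by (smt (verit, ccfv_SIG) UnI1 equals0I image_iff zero_le_dist)
    thus False using MP by simp
  next
    case False
    text \<open>The lift to the paraboloid turns the ball into a half-space.\<close>
    define b where "b = r\<^sup>2 - c \<bullet> c"
    have half: "dist c (z i) \<le> r \<longleftrightarrow> (- 2 *\<^sub>R c, 1) \<bullet> w i \<le> b" for i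
    proof -
      have "dist c (z i) \<le> r \<longleftrightarrow> (dist c (z i))\<^sup>2 \<le> r\<^sup>2"
        using False by (simp add: abs_le_square_iff[symmetric])
      also have "(dist c (z i))\<^sup>2 = c \<bullet> c - 2 * (c \<bullet> z i) + z i \<bullet> z i"
        by (simp add: dist_norm power2_norm_eq_inner inner_diff inner_commute)
      finally show ?thesis by (auto simp: w_def b_def)
    qed
    have "convex hull M \<subseteq> {v. (- 2 *\<^sub>R c, 1) \<bullet> v \<le> b}"
    proof (intro hull_minimal convex_halfspace_le subsetI)
      fix v assume v: "v \<in> M"
      then obtain i where "i \<in> J" "v = w i" using MP(2) by auto
      thus "v \<in> {v. (- 2 *\<^sub>R c, 1) \<bullet> v \<le> b}" using v w_iff half by auto
    qed
    moreover have "convex hull P \<subseteq> {v. (- 2 *\<^sub>R c, 1) \<bullet> v > b}"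
    proof (intro hull_minimal convex_halfspace_gt subsetI)
      fix v assume v: "v \<in> P"
      then obtain i where "i \<in> J" "v = w i" using MP(2) by auto
      moreover have "v \<notin> M" using v MP(1) by auto
      ultimately show "v \<in> {v. (- 2 *\<^sub>R c, 1) \<bullet> v > b}" using w_iff half by auto
    qed
    ultimately show False using MP(3) by fastforce
  qed
qed

text \<open>Centres and radii range over infinite sets, but every shattered index set has at most
  \<open>DIM('a) + 2\<close> elements, and counting such sets bounds the number of traces.\<close>

lemma ball_traces_card_le:
  fixes z :: "nat \<Rightarrow> 'a::euclidean_space"
  shows "card (range (\<lambda>(c, r). {i \<in> {..<m}. dist c (z i) \<le> r})) \<le> (m + 1) ^ (DIM('a) + 2)"
    (is "card ?F \<le> _")
proof -
  have sub: "?F \<subseteq> Pow {..<m}" by auto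
  have "card ?F \<le> card (shattered ?F)"
    using sub by (intro card_le_card_shattered[of "{..<m}"]) auto
  also have "\<dots> \<le> card {J. J \<subseteq> {..<m} \<and> card J \<le> DIM('a) + 2}"
  proof (rule card_mono)
    show "shattered ?F \<subseteq> {J. J \<subseteq> {..<m} \<and> card J \<le> DIM('a) + 2}"
    proof safe
      fix J assume J: "J \<in> shattered ?F"
      thus "i \<in> J \<Longrightarrow> i < m" for i using shattered_subset[OF sub] by auto
      have Jm: "J \<subseteq> {..<m}" using J shattered_subset[OF sub] by auto
      show "card J \<le> DIM('a) + 2"
      proof (rule ball_shattered_card_le)
        show "finite J" using Jm finite_subset by auto
        show "\<forall>T\<subseteq>J. \<exists>c r. {i \<in> J. dist c (z i) \<le> r} = T"
        proof safe
          fix T assume "T \<subseteq> J"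
          then obtain A where "A \<in> ?F" "A \<inter> J = T" using J unfolding shattered_def by blast
          then obtain c r where "{i \<in> {..<m}. dist c (z i) \<le> r} \<inter> J = T" by auto
          moreover have "{i \<in> {..<m}. dist c (z i) \<le> r} \<inter> J = {i \<in> J. dist c (z i) \<le> r}" using Jm by auto
          ultimately show "\<exists>c r. {i \<in> J. dist c (z i) \<le> r} = T" by blast
        qed
      qed
    qed
  qed (use card_bounded_subsets_le in blast)
  also have "\<dots> \<le> (m + 1) ^ (DIM('a) + 2)"
    using card_bounded_subsets_le by blast
  finally show ?thesis .
qed

subsection \<open>Uniform deviations by symmetrisation\<close>

text \<open>The index set is a parameter so that the two halves of a double sample can be counted
  separately.\<close>

definition hits :: "'i set \<Rightarrow> ('i \<Rightarrow> 'b) \<Rightarrow> 'b set \<Rightarrow> real" where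
  "hits I S A = (\<Sum>i\<in>I. indicator A (S i))"

lemma hits_eq_card: "finite I \<Longrightarrow> hits I S A = card {i \<in> I. S i \<in> A}"
  by (simp add: hits_def indicator_def sum.If_cases Int_def)

lemma hits_nonneg: "hits I S A \<ge> 0"
  by (simp add: hits_def sum_nonneg)

lemma measurable_hits [measurable]:
  assumes "A \<in> sets M" "I \<subseteq> K"
  shows "(\<lambda>S. hits I S A) \<in> borel_measurable (PiM K (\<lambda>_. M))"
  unfolding hits_def
proof (rule borel_measurable_sum)
  fix i assume "i \<in> I"
  hence [measurable]: "(\<lambda>S. S i) \<in> measurable (PiM K (\<lambda>_. M)) M"
    using assms by (intro measurable_component_singleton) auto
  note assms(1)[measurable]
  show "(\<lambda>S. indicator A (S i)) \<in> borel_measurable (PiM K (\<lambda>_. M))"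
    by measurable
qed

text \<open>The joint law of the coordinates is the product measure itself, hence the product of the
  marginal laws, and this characterises independence.\<close>

lemma (in prob_space) indep_vars_PiM_coordinates:
  assumes "I \<noteq> {}"
  shows "prob_space.indep_vars (PiM I (\<lambda>_. M)) (\<lambda>_. M) (\<lambda>i S. S i) I"
proof -
  interpret P: prob_space "PiM I (\<lambda>_. M)"
    by (intro prob_space_PiM prob_space_axioms)
  have "distr (PiM I (\<lambda>_. M)) (PiM I (\<lambda>_. M)) (\<lambda>S. \<lambda>i\<in>I. S i) = PiM I (\<lambda>_. M)"
    using distr_PiM_reindex[of I "\<lambda>_. M" "\<lambda>i. i" I] prob_space_axioms by simp
  also have "\<dots> = PiM I (\<lambda>i. distr (PiM I (\<lambda>_. M)) M (\<lambda>S. S i))"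
    using prob_space_axioms
    by (intro PiM_cong refl distr_PiM_component[where M = "\<lambda>_. M", symmetric])
  finally show ?thesis
    using assms by (subst P.indep_vars_iff_distr_eq_PiM') auto
qed

text \<open>Hoeffding's inequality at deviation \<open>sqrt (card J)\<close> yields
  \<open>2 * exp (- 2)\<close>. It is used to say that a ghost sample is typical for one fixed set
  with probability at least one half.\<close>

lemma (in prob_space) hits_deviation_half:
  assumes J: "finite J" "J \<noteq> {}" and A: "A \<in> sets M"
  shows "measure (PiM J (\<lambda>_. M))
    {S \<in> space (PiM J (\<lambda>_. M)). sqrt (card J) \<le> \<bar>hits J S A - card J * prob A\<bar>} \<le> 1 / 2"
proof -
  interpret P: prob_space "PiM J (\<lambda>_. M)"
    by (intro prob_space_PiM prob_space_axioms)
  note A[measurable]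
  have cm: "(\<lambda>S. S i) \<in> measurable (PiM J (\<lambda>_. M)) M" if "i \<in> J" for i
    using that by (intro measurable_component_singleton)
  have ex: "P.expectation (\<lambda>S. indicator A (S i)) = prob A" if "i \<in> J" for i
  proof -
    have "P.expectation (\<lambda>S. indicator A (S i)) = (\<integral>x. (indicator A x :: real) \<partial>distr (PiM J (\<lambda>_. M)) M (\<lambda>S. S i))"
      using A by (intro integral_distr[OF cm[OF that], of "indicator A", symmetric]) simp
    also have "\<dots> = prob A"
      using that prob_space_axioms A by (subst distr_PiM_component) auto
    finally show ?thesis .
  qed
  interpret H: Hoeffding_ineq "PiM J (\<lambda>_. M)" J "\<lambda>i S. indicator A (S i)" "\<lambda>_. 0" "\<lambda>_. 1"
    "\<Sum>i\<in>J. P.expectation (\<lambda>S. indicator A (S i))"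
  proof unfold_locales
    show "P.indep_vars (\<lambda>_. borel) (\<lambda>i S. indicator A (S i)) J"
      by (rule P.indep_vars_compose2[OF indep_vars_PiM_coordinates[OF J(2)]]) auto
  qed (use J in \<open>auto simp: indicator_def\<close>)
  have "card J > 0" using J by (simp add: card_gt_0_iff)
  have mu: "(\<Sum>i\<in>J. P.expectation (\<lambda>S. indicator A (S i))) = card J * prob A"
    by (simp add: ex)
  have "P.prob {S \<in> space (PiM J (\<lambda>_. M)). \<bar>(\<Sum>i\<in>J. indicator A (S i)) -
      (\<Sum>i\<in>J. P.expectation (\<lambda>S. indicator A (S i)))\<bar> \<ge> sqrt (card J)} \<le>
      2 * exp (-2 * (sqrt (card J))\<^sup>2 / (\<Sum>i\<in>J. (1 - 0)\<^sup>2))"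
    using \<open>card J > 0\<close> by (intro H.Hoeffding_ineq_abs_ge) auto
  also have "\<dots> = 2 * exp (- 2)" using \<open>card J > 0\<close> by simp
  also have "\<dots> \<le> 1 / 2"
  proof -
    have "(2::real) ^ 2 \<le> exp 1 ^ 2"
      using exp_ge_add_one_self[of "1::real"] by (intro power_mono) auto
    hence "4 \<le> exp (2::real)" by (simp flip: exp_of_nat_mult)
    thus ?thesis by (simp add: exp_minus field_simps)
  qed
  finally show ?thesis by (simp add: hits_def mu)
qed

text \<open>The deterministic half of symmetrisation, for a sample count \<open>c\<close>, a ghost
  count \<open>c'\<close> and their common mean \<open>m\<close>. With
  \<open>d = \<bar>c - c'\<bar>\<close>, one has \<open>c' \<le> K + s\<close> and
  \<open>c + c' \<le> 2 * c' + d\<close>, so \<open>d > 2 * L + 2 * u\<close> gives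
  \<open>2 * L * (c + c') \<le> 4 * u\<^sup>2 + 2 * L * d < d\<^sup>2\<close>.\<close>

lemma deviation_imp_ghost_deviation:
  fixes c c' m K L s :: real
  assumes "0 \<le> c" "0 \<le> c'" "0 \<le> m" "m \<le> K" "0 < L" "0 \<le> s"
    and "\<bar>c' - m\<bar> < s" and "s + 2 * L + 2 * sqrt (L * (K + s)) < \<bar>c - m\<bar>"
  shows "sqrt (2 * L * (c + c')) < \<bar>c - c'\<bar>"
proof -
  define u where "u = sqrt (L * (K + s))"
  define d where "d = \<bar>c - c'\<bar>"
  have u: "u \<ge> 0" "u\<^sup>2 = L * (K + s)" using assms by (auto simp: u_def)
  have d: "d > 2 * L + 2 * u" using assms by (auto simp: u_def d_def)
  have "L * c' \<le> u\<^sup>2" using assms u by (auto intro!: mult_left_mono)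
  moreover have "L * (c + c') \<le> L * (2 * c' + d)" using assms by (auto simp: d_def intro!: mult_left_mono)
  ultimately have "2 * L * (c + c') \<le> 4 * u\<^sup>2 + 2 * L * d" by (simp add: algebra_simps)
  moreover have "(2 * u) * (2 * u) < d * (d - 2 * L)"
    using u d assms by (intro mult_strict_mono') auto
  ultimately have "2 * L * (c + c') < d\<^sup>2" by (simp add: algebra_simps power2_eq_square)
  moreover have "d > 0" using d u assms by auto
  ultimately show ?thesis
    unfolding d_def[symmetric] by (intro real_less_lsqrt) auto
qed

text \<open>For \<open>X \<subseteq> {..<n}\<close> this is the involution of
  \<open>{..<2 * n}\<close> that exchanges \<open>i\<close> and \<open>n + i\<close> exactly when
  \<open>i \<in> X\<close>. The set \<open>X\<close> plays the role of a sign vector.\<close>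

definition swap_halves :: "nat \<Rightarrow> nat set \<Rightarrow> nat \<Rightarrow> nat" where
  "swap_halves n X i = (if i < n then (if i \<in> X then n + i else i) else (if i - n \<in> X then i - n else i))"

lemma sum_upper_half: "(\<Sum>i\<in>{n..<2 * n}. f i) = (\<Sum>i<n. f (n + i))" for f :: "nat \<Rightarrow> 'c::comm_monoid_add"
  by (rule sum.reindex_bij_witness[of _ "\<lambda>i. n + i" "\<lambda>i. i - n"]) auto

lemma sum_two_halves: "(\<Sum>i<2 * n. f i) = (\<Sum>i<n. f i + f (n + i))" for f :: "nat \<Rightarrow> 'c::comm_monoid_add"
proof -
  have halves: "{..<2 * n} = {..<n} \<union> {n..<2 * n}" by auto
  have "(\<Sum>i<2 * n. f i) = (\<Sum>i<n. f i) + (\<Sum>i\<in>{n..<2 * n}. f i)"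
    unfolding halves by (intro sum.union_disjoint) auto
  thus ?thesis by (simp add: sum_upper_half sum.distrib)
qed

text \<open>With the double sample \<open>\<omega>\<close> fixed, a set matters only through its
  trace on \<open>\<omega>\<close>. Each of the at most \<open>g\<close> traces gives a Rademacher
  sum in the swap \<open>X\<close>, and a union bound over the traces finishes.\<close>

lemma card_swaps_le:
  assumes C: "card ((\<lambda>A. {i \<in> {..<2 * n}. \<omega> i \<in> A}) ` C) \<le> g" and L: "0 < L"
  shows "card {X \<in> Pow {..<n}. \<exists>A\<in>C. sqrt (2 * L * hits {..<2 * n} (\<lambda>i\<in>{..<2 * n}. \<omega> (swap_halves n X i)) A)
      < \<bar>hits {..<n} (\<lambda>i\<in>{..<2 * n}. \<omega> (swap_halves n X i)) A
        - hits {n..<2 * n} (\<lambda>i\<in>{..<2 * n}. \<omega> (swap_halves n X i)) A\<bar>}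
    \<le> g * (2 * exp (- L) * 2 ^ n)"
    (is "real (card ?B) \<le> _")
proof -
  let ?t = "\<lambda>A. {i \<in> {..<2 * n}. \<omega> i \<in> A}"
  define a :: "nat set \<Rightarrow> nat \<Rightarrow> real" where "a = (\<lambda>T i. indicator T i - indicator T (n + i))"
  define V :: "nat set \<Rightarrow> real" where "V = (\<lambda>T. \<Sum>i<n. indicator T i + indicator T (n + i))"
  define h where "h = (\<lambda>T. {X \<in> Pow {..<n}. sqrt (2 * L * V T) < \<bar>sum (a T) X - sum (a T) ({..<n} - X)\<bar>})"
  have fin: "finite (?t ` C)"
    by (rule finite_subset[of _ "Pow {..<2 * n}"]) auto
  have "?B \<subseteq> (\<Union>T\<in>?t ` C. h T)"
  proof safe
    fix X A
    let ?\<omega> = "\<lambda>i\<in>{..<2 * n}. \<omega> (swap_halves n X i)"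
    assume X: "X \<subseteq> {..<n}" and A: "A \<in> C"
      and gt: "sqrt (2 * L * hits {..<2 * n} ?\<omega> A) < \<bar>hits {..<n} ?\<omega> A - hits {n..<2 * n} ?\<omega> A\<bar>"
    have ind: "indicator A (\<omega> i) = (indicator (?t A) i :: real)" if "i < 2 * n" for i
      using that by (auto simp: indicator_def)
    have "hits {..<2 * n} ?\<omega> A = (\<Sum>i<n. indicator A (?\<omega> i) + indicator A (?\<omega> (n + i)))"
      unfolding hits_def by (rule sum_two_halves)
    also have "\<dots> = V (?t A)"
      unfolding V_def by (intro sum.cong refl) (auto simp: swap_halves_def indicator_def)
    finally have 1: "hits {..<2 * n} ?\<omega> A = V (?t A)" .
    have "hits {..<n} ?\<omega> A - hits {n..<2 * n} ?\<omega> A = (\<Sum>i<n. indicator A (?\<omega> i) - indicator A (?\<omega> (n + i)))"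
      unfolding hits_def sum_upper_half by (rule sum_subtractf[symmetric])
    \<comment> \<open>Swapping \<open>i\<close> with \<open>n + i\<close> flips the sign of the
      \<open>i\<close>-th difference, whereas the total count \<open>V\<close> is
      unaffected.\<close>
    also have "\<dots> = (\<Sum>i<n. if i \<in> X then - a (?t A) i else a (?t A) i)"
      unfolding a_def by (intro sum.cong refl) (auto simp: swap_halves_def indicator_def)
    also have "\<dots> = - (sum (a (?t A)) X - sum (a (?t A)) ({..<n} - X))"
      using X by (simp add: sum.If_cases sum_negf Int_absorb1 Diff_eq Int_absorb2)
    finally have 2: "\<bar>hits {..<n} ?\<omega> A - hits {n..<2 * n} ?\<omega> A\<bar> = \<bar>sum (a (?t A)) X - sum (a (?t A)) ({..<n} - X)\<bar>"
      by (simp only: abs_minus_cancel)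
    have "X \<in> h (?t A)"
      unfolding h_def using gt X unfolding 1 2 by blast
    thus "X \<in> (\<Union>T\<in>?t ` C. h T)" using A by blast
  qed
  moreover have "finite (\<Union>T\<in>?t ` C. h T)"
    by (rule finite_subset[of _ "Pow {..<n}"]) (auto simp: h_def)
  ultimately have "card ?B \<le> card (\<Union>T\<in>?t ` C. h T)"
    by (intro card_mono)
  also have "\<dots> \<le> (\<Sum>T\<in>?t ` C. card (h T))"
    using fin by (rule card_UN_le)
  finally have "real (card ?B) \<le> (\<Sum>T\<in>?t ` C. real (card (h T)))"
    by (simp only: of_nat_le_iff flip: of_nat_sum)
  also have "\<dots> \<le> (\<Sum>T\<in>?t ` C. 2 * exp (- L) * 2 ^ n)"
  proof (rule sum_mono)
    fix T
    \<comment> \<open>For \<open>s\<close> and \<open>t\<close> in \<open>{0, 1}\<close> one has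
      \<open>(s - t)\<^sup>2 \<le> s + t\<close>, so the total count is a variance proxy.\<close>
    have "(\<Sum>i<n. (a T i)\<^sup>2) \<le> V T"
      unfolding V_def a_def by (intro sum_mono) (auto simp: indicator_def)
    from card_abs_sign_sum_gt[OF _ this L] show "real (card (h T)) \<le> 2 * exp (- L) * 2 ^ n"
      by (simp add: h_def)
  qed
  also have "\<dots> \<le> g * (2 * exp (- L) * 2 ^ n)"
    using C by (simp add: mult_right_mono)
  finally show ?thesis .
qed


text \<open>Every swap preserves the product measure, so the probability of \<open>Ev\<close> equals
  its average over all \<open>2 ^ n\<close> swaps. Exchanging this average with the integral leaves
  a count for each fixed \<open>\<omega>\<close>, bounded by \<open>card_swaps_le\<close>.\<close>

lemma (in prob_space) ghost_event_prob_le: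
  fixes n g :: nat and L :: real
  assumes C: "countable C" "C \<subseteq> sets M"
    and g: "\<And>\<omega>. card ((\<lambda>A. {i \<in> {..<2 * n}. \<omega> i \<in> A}) ` C) \<le> g" and L: "0 < L"
  defines "Ev \<equiv> {\<omega> \<in> space (PiM {..<2 * n} (\<lambda>_. M)). \<exists>A\<in>C.
      sqrt (2 * L * hits {..<2 * n} \<omega> A) < \<bar>hits {..<n} \<omega> A - hits {n..<2 * n} \<omega> A\<bar>}"
  shows "Ev \<in> sets (PiM {..<2 * n} (\<lambda>_. M))"
    and "measure (PiM {..<2 * n} (\<lambda>_. M)) Ev \<le> 2 * g * exp (- L)"
proof -
  let ?P = "PiM {..<2 * n} (\<lambda>_. M)"
  interpret P: prob_space ?P
    by (intro prob_space_PiM prob_space_axioms)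
  \<comment> \<open>Countability of \<open>C\<close> is what makes the supremum event
    measurable.\<close>
  have "Ev = (\<Union>A\<in>C. {\<omega> \<in> space ?P.
      sqrt (2 * L * hits {..<2 * n} \<omega> A) < \<bar>hits {..<n} \<omega> A - hits {n..<2 * n} \<omega> A\<bar>})"
    by (auto simp: Ev_def)
  also have "\<dots> \<in> sets ?P"
  proof (intro sets.countable_UN'[OF C(1)] image_subsetI)
    fix A assume "A \<in> C"
    hence A: "A \<in> sets M" using C by auto
    have [measurable]: "(\<lambda>\<omega>. hits {..<2 * n} \<omega> A) \<in> borel_measurable ?P"
        "(\<lambda>\<omega>. hits {..<n} \<omega> A) \<in> borel_measurable ?P"
        "(\<lambda>\<omega>. hits {n..<2 * n} \<omega> A) \<in> borel_measurable ?P"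
      by (rule measurable_hits[OF A]; auto)+
    show "{\<omega> \<in> space ?P. sqrt (2 * L * hits {..<2 * n} \<omega> A)
        < \<bar>hits {..<n} \<omega> A - hits {n..<2 * n} \<omega> A\<bar>} \<in> sets ?P"
      by measurable
  qed
  finally show Ev: "Ev \<in> sets ?P" .
  define sw where "sw = (\<lambda>X \<omega>. \<lambda>i\<in>{..<2 * n}. (\<omega> (swap_halves n X i) :: 'a))"
  have inv: "swap_halves n X i < 2 * n" "swap_halves n X (swap_halves n X i) = i"
    if "i < 2 * n" "X \<subseteq> {..<n}" for X i
    using that by (auto simp: swap_halves_def)
  have sw: "sw X \<in> measurable ?P ?P" "distr ?P ?P (sw X) = ?P" if X: "X \<subseteq> {..<n}" for X
  proof -
    have "inj_on (swap_halves n X) {..<2 * n}"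
      by (rule inj_on_inverseI[of _ "swap_halves n X"]) (use inv X in auto)
    moreover have "swap_halves n X \<in> {..<2 * n} \<rightarrow> {..<2 * n}"
      using inv X by auto
    ultimately show "distr ?P ?P (sw X) = ?P"
      using distr_PiM_reindex[of "{..<2 * n}" "\<lambda>_. M" "swap_halves n X" "{..<2 * n}"] prob_space_axioms
      by (simp add: sw_def)
    show "sw X \<in> measurable ?P ?P"
      unfolding sw_def using inv X
      by (intro measurable_restrict measurable_component_singleton) auto
  qed
  have mem: "sw X \<omega> \<in> space ?P" if "X \<subseteq> {..<n}" "\<omega> \<in> space ?P" for X \<omega>
    using sw(1)[OF that(1)] that(2) by (rule measurable_space)
  have int: "integrable ?P (\<lambda>\<omega>. indicator Ev (sw X \<omega>) :: real)" if "X \<in> Pow {..<n}" for X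
  proof (rule P.integrable_const_bound[of _ 1])
    show "(\<lambda>\<omega>. indicator Ev (sw X \<omega>) :: real) \<in> borel_measurable ?P"
      using sw(1)[of X] that Ev by simp
  qed (auto simp: indicator_def)
  have "2 ^ n * P.prob Ev = (\<Sum>X\<in>Pow {..<n}. P.prob Ev)"
    by (simp add: card_Pow)
  also have "\<dots> = (\<Sum>X\<in>Pow {..<n}. \<integral>\<omega>. indicator Ev (sw X \<omega>) \<partial>?P)"
  proof (intro sum.cong refl)
    fix X assume X: "X \<in> Pow {..<n}"
    have "P.prob Ev = (\<integral>\<omega>. indicator Ev \<omega> \<partial>distr ?P ?P (sw X))"
      using X sw(2)[of X] Ev by simp
    also have "\<dots> = (\<integral>\<omega>. indicator Ev (sw X \<omega>) \<partial>?P)"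
      using X sw(1)[of X] Ev by (intro integral_distr) auto
    finally show "P.prob Ev = (\<integral>\<omega>. indicator Ev (sw X \<omega>) \<partial>?P)" .
  qed
  also have "\<dots> = (\<integral>\<omega>. (\<Sum>X\<in>Pow {..<n}. indicator Ev (sw X \<omega>)) \<partial>?P)"
    using int by (intro Bochner_Integration.integral_sum[symmetric])
  also have "\<dots> \<le> (\<integral>\<omega>. g * (2 * exp (- L) * 2 ^ n) \<partial>?P)"
  proof (intro integral_mono)
    fix \<omega> assume \<omega>: "\<omega> \<in> space ?P"
    have "(\<Sum>X\<in>Pow {..<n}. indicator Ev (sw X \<omega>)) = real (card {X \<in> Pow {..<n}. sw X \<omega> \<in> Ev})"
      by (simp add: indicator_def sum.If_cases Int_def)
    also have "{X \<in> Pow {..<n}. sw X \<omega> \<in> Ev} = {X \<in> Pow {..<n}. \<exists>A\<in>C.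
      sqrt (2 * L * hits {..<2 * n} (sw X \<omega>) A) < \<bar>hits {..<n} (sw X \<omega>) A - hits {n..<2 * n} (sw X \<omega>) A\<bar>}"
      using mem \<omega> unfolding Ev_def by blast
    also have "real (card \<dots>) \<le> g * (2 * exp (- L) * 2 ^ n)"
      unfolding sw_def by (rule card_swaps_le[OF g L])
    finally show "(\<Sum>X\<in>Pow {..<n}. indicator Ev (sw X \<omega>)) \<le> g * (2 * exp (- L) * 2 ^ n)" .
  qed (use int in auto)
  also have "\<dots> = 2 ^ n * (2 * g * exp (- L))"
    using P.prob_space by simp
  finally show "P.prob Ev \<le> 2 * g * exp (- L)"
    by simp
qed

text \<open>Symmetrisation: whenever the sample deviates on some set, an independent ghost sample
  lands in the event of \<open>ghost_event_prob_le\<close> with conditional probability at least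
  \<open>1 / 2\<close>. This doubles the constant \<open>2\<close> found there to \<open>4\<close>.
  The bound \<open>K\<close> on the expected counts limits the variance.\<close>

theorem (in prob_space) uniform_deviation:
  fixes n g :: nat and K L :: real
  assumes C: "countable C" "C \<subseteq> sets M" and K: "\<And>A. A \<in> C \<Longrightarrow> n * prob A \<le> K" and n: "0 < n"
    and g: "\<And>\<omega>. card ((\<lambda>A. {i \<in> {..<2 * n}. \<omega> i \<in> A}) ` C) \<le> g" and L: "0 < L"
  defines "T \<equiv> sqrt n + 2 * L + 2 * sqrt (L * (K + sqrt n))"
  defines "Bad \<equiv> {S \<in> space (PiM {..<n} (\<lambda>_. M)). \<exists>A\<in>C. T < \<bar>hits {..<n} S A - n * prob A\<bar>}"
  shows "Bad \<in> sets (PiM {..<n} (\<lambda>_. M))"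
    and "measure (PiM {..<n} (\<lambda>_. M)) Bad \<le> 4 * g * exp (- L)"
proof -
  let ?P = "PiM {..<n} (\<lambda>_. M)" and ?Q = "PiM {n..<2 * n} (\<lambda>_. M)" and ?PP = "PiM {..<2 * n} (\<lambda>_. M)"
  interpret P: prob_space ?P
    by (intro prob_space_PiM prob_space_axioms)
  interpret Q: prob_space ?Q
    by (intro prob_space_PiM prob_space_axioms)
  interpret PP: prob_space ?PP
    by (intro prob_space_PiM prob_space_axioms)
  interpret S: product_sigma_finite "\<lambda>_::nat. M"
    by standard
  have "Bad = (\<Union>A\<in>C. {S \<in> space ?P. T < \<bar>hits {..<n} S A - n * prob A\<bar>})"
    by (auto simp: Bad_def)
  also have "\<dots> \<in> sets ?P"
  proof (intro sets.countable_UN'[OF C(1)] image_subsetI)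
    fix A assume "A \<in> C"
    hence A: "A \<in> sets M" using C by auto
    have [measurable]: "(\<lambda>\<omega>. hits {..<n} \<omega> A) \<in> borel_measurable ?P"
      by (rule measurable_hits[OF A]; auto)
    show "{S \<in> space ?P. T < \<bar>hits {..<n} S A - n * prob A\<bar>} \<in> sets ?P"
      by measurable
  qed
  finally show Bad: "Bad \<in> sets ?P" .
  define Ev where "Ev = {\<omega> \<in> space ?PP. \<exists>A\<in>C.
      sqrt (2 * L * hits {..<2 * n} \<omega> A) < \<bar>hits {..<n} \<omega> A - hits {n..<2 * n} \<omega> A\<bar>}"
  note Ev = ghost_event_prob_le[OF C g L, folded Ev_def]
  have halves: "{..<n} \<union> {n..<2 * n} = {..<2 * n}" by auto
  have "ennreal (1 / 2) * emeasure ?P Bad = (\<integral>\<^sup>+S. ennreal (1 / 2) * indicator Bad S \<partial>?P)"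
    using Bad by (intro nn_integral_cmult_indicator[symmetric])
  also have "\<dots> \<le> (\<integral>\<^sup>+S. emeasure ?Q ((\<lambda>S'. merge {..<n} {n..<2 * n} (S, S')) -` Ev \<inter> space ?Q) \<partial>?P)"
  proof (intro nn_integral_mono)
    fix S assume S: "S \<in> space ?P"
    show "ennreal (1 / 2) * indicator Bad S \<le>
        emeasure ?Q ((\<lambda>S'. merge {..<n} {n..<2 * n} (S, S')) -` Ev \<inter> space ?Q)"
    proof (cases "S \<in> Bad")
      case True
      \<comment> \<open>The witness depends on \<open>S\<close> alone, so for the ghost half the
        deviation bound for a single set is enough.\<close>
      then obtain A where A: "A \<in> C" "T < \<bar>hits {..<n} S A - n * prob A\<bar>"
        by (auto simp: Bad_def)
      hence A': "A \<in> sets M" using C by auto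
      let ?far = "{S' \<in> space ?Q. sqrt n \<le> \<bar>hits {n..<2 * n} S' A - n * prob A\<bar>}"
      have [measurable]: "(\<lambda>\<omega>. hits {n..<2 * n} \<omega> A) \<in> borel_measurable ?Q"
        by (rule measurable_hits[OF A']; auto)
      have far: "?far \<in> sets ?Q" by measurable
      have "Q.prob ?far \<le> 1 / 2"
        using hits_deviation_half[of "{n..<2 * n}" A] n A' by simp
      hence "1 / 2 \<le> Q.prob (space ?Q - ?far)"
        using far by (simp add: Q.prob_compl)
      hence "ennreal (1 / 2) \<le> emeasure ?Q (space ?Q - ?far)"
        unfolding Q.emeasure_eq_measure by (rule ennreal_leI)
      also have "\<dots> \<le> emeasure ?Q ((\<lambda>S'. merge {..<n} {n..<2 * n} (S, S')) -` Ev \<inter> space ?Q)"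
      proof (rule emeasure_mono)
        show "space ?Q - ?far \<subseteq> (\<lambda>S'. merge {..<n} {n..<2 * n} (S, S')) -` Ev \<inter> space ?Q"
        proof
          fix S' assume S': "S' \<in> space ?Q - ?far"
          define \<omega> where "\<omega> = merge {..<n} {n..<2 * n} (S, S')"
          have h: "hits {..<n} \<omega> A = hits {..<n} S A" "hits {n..<2 * n} \<omega> A = hits {n..<2 * n} S' A"
            unfolding hits_def \<omega>_def by (auto intro!: sum.cong simp: merge_def)
          have h2: "hits {..<2 * n} \<omega> A = hits {..<n} \<omega> A + hits {n..<2 * n} \<omega> A"
            unfolding hits_def halves[symmetric] by (rule sum.union_disjoint) auto
          have "\<omega> \<in> space ?PP"
            using S S' unfolding \<omega>_def halves[symmetric] by (auto simp: space_PiM PiE_def merge_def extensional_def)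
          moreover have "sqrt (2 * L * hits {..<2 * n} \<omega> A) < \<bar>hits {..<n} \<omega> A - hits {n..<2 * n} \<omega> A\<bar>"
            unfolding h2
          proof (rule deviation_imp_ghost_deviation)
            show "n * prob A \<le> K" using K A by auto
            show "\<bar>hits {n..<2 * n} \<omega> A - n * prob A\<bar> < sqrt n" using S' h by auto
            show "sqrt n + 2 * L + 2 * sqrt (L * (K + sqrt n)) < \<bar>hits {..<n} \<omega> A - n * prob A\<bar>"
              using A h by (simp add: T_def)
          qed (auto simp: hits_nonneg L)
          ultimately have "\<omega> \<in> Ev" unfolding Ev_def using A(1) by blast
          thus "S' \<in> (\<lambda>S'. merge {..<n} {n..<2 * n} (S, S')) -` Ev \<inter> space ?Q"
            using S' by (simp add: \<omega>_def)
        qed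
        have "(\<lambda>S'. merge {..<n} {n..<2 * n} (S, S')) \<in> measurable ?Q ?PP"
          unfolding halves[symmetric]
          by (rule measurable_compose[OF measurable_Pair1'[OF S] measurable_merge])
        thus "(\<lambda>S'. merge {..<n} {n..<2 * n} (S, S')) -` Ev \<inter> space ?Q \<in> sets ?Q"
          using Ev(1) by (rule measurable_sets)
      qed
      finally show ?thesis using True by simp
    qed simp
  qed
  \<comment> \<open>Fubini for the splitting of \<open>{..<2 * n}\<close> into its two
    halves.\<close>
  also have "\<dots> = emeasure ?PP Ev"
    by (rule S.emeasure_fold_integral[of "{..<n}" "{n..<2 * n}" Ev, unfolded halves, symmetric])
      (auto simp: Ev(1))
  finally have "ennreal (1 / 2 * P.prob Bad) \<le> ennreal (PP.prob Ev)"
    unfolding P.emeasure_eq_measure PP.emeasure_eq_measure by (subst ennreal_mult'') auto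
  hence "1 / 2 * P.prob Bad \<le> PP.prob Ev"
    by (simp only: ennreal_le_iff measure_nonneg)
  thus "P.prob Bad \<le> 4 * g * exp (- L)"
    using Ev(2) by simp
qed

subsection \<open>The distribution of a labelled sample point\<close>

locale label_model =
  fixes Xs :: "'a::euclidean_space set" and p eta :: "'a \<Rightarrow> real"
  assumes compact_Xs: "compact Xs"
    and p_measurable [measurable]: "p \<in> borel_measurable lborel"
    and p_nonneg: "\<And>x. 0 \<le> p x"
    and p_integrable: "set_integrable lborel Xs p"
    and p_total: "(LINT x:Xs|lborel. p x) = 1"
    and eta_measurable [measurable]: "eta \<in> borel_measurable lborel"
    and eta_range: "\<And>x. x \<in> Xs \<Longrightarrow> 0 \<le> eta x \<and> eta x \<le> 1"
begin

abbreviation "M \<equiv> sample_dist Xs p eta"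

text \<open>The Lebesgue density of the position on the slice of label \<open>b\<close>; the two
  slices add up to the density of the position.\<close>

definition dens :: "bool \<Rightarrow> 'a \<Rightarrow> real" where
  "dens b x = indicator Xs x * p x * (if b then eta x else 1 - eta x)"

lemma Xs_borel [measurable]: "Xs \<in> sets borel"
  by (rule borel_closed[OF compact_imp_closed[OF compact_Xs]])

lemma dens_nonneg: "0 \<le> dens b x"
  using p_nonneg[of x] eta_range[of x] by (auto simp: dens_def indicator_def)

lemma dens_measurable [measurable]: "dens b \<in> borel_measurable borel"
  using p_measurable eta_measurable unfolding dens_def by measurable

lemma dens_sum: "dens True x + dens False x = indicator Xs x * p x"
  by (simp add: dens_def algebra_simps)

lemma dens_integrable: "integrable lborel (dens b)"
proof (rule Bochner_Integration.integrable_bound)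
  show "integrable lborel (\<lambda>x. indicator Xs x * p x)"
    using p_integrable by (simp add: set_integrable_def)
  show "AE x in lborel. norm (dens b x) \<le> norm (indicator Xs x * p x)"
  proof (rule AE_I2)
    fix x
    show "norm (dens b x) \<le> norm (indicator Xs x * p x)"
      using p_nonneg[of x] eta_range[of x] by (auto simp: dens_def indicator_def intro!: mult_left_le)
  qed
qed simp

lemma sets_M: "sets M = sets (borel \<Otimes>\<^sub>M count_space UNIV)"
  unfolding sample_dist_def sets_density by (intro sets_pair_measure_cong) auto

lemma space_M: "space M = UNIV"
  by (simp add: sample_dist_def space_pair_measure)

lemma Times_sets_M [measurable]: "B \<in> sets borel \<Longrightarrow> B \<times> V \<in> sets M"
  by (simp add: sets_M)

text \<open>Integrate out the label first: the label space is finite, so the inner integral is a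
  sum.\<close>

lemma emeasure_M:
  assumes [measurable]: "B \<in> sets borel"
  shows "emeasure M (B \<times> V) = (\<integral>\<^sup>+x. (\<Sum>b\<in>V. ennreal (dens b x)) * indicator B x \<partial>lborel)"
proof -
  interpret C: sigma_finite_measure "count_space (UNIV :: bool set)"
    by (rule sigma_finite_measure_count_space_finite) simp
  have m: "(\<lambda>(x, b). ennreal (dens b x)) \<in> borel_measurable (lborel \<Otimes>\<^sub>M count_space UNIV)"
  proof -
    have "(\<lambda>z. ennreal (if snd z then dens True (fst z) else dens False (fst z)))
        \<in> borel_measurable (lborel \<Otimes>\<^sub>M count_space UNIV)"
      by measurable
    moreover have "(if snd z then dens True (fst z) else dens False (fst z)) = dens (snd z) (fst z)" for z
      by auto
    ultimately show ?thesis
      by (simp add: case_prod_beta)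
  qed
  have "emeasure M (B \<times> V) = (\<integral>\<^sup>+z. (case z of (x, b) \<Rightarrow> ennreal (dens b x)) * indicator (B \<times> V) z
      \<partial>(lborel \<Otimes>\<^sub>M count_space UNIV))"
    unfolding sample_dist_def using m
    by (subst emeasure_density) (auto simp: dens_def[abs_def])
  also have "\<dots> = (\<integral>\<^sup>+x. \<integral>\<^sup>+b. ennreal (dens b x) * indicator (B \<times> V) (x, b) \<partial>count_space UNIV \<partial>lborel)"
    using m by (subst C.nn_integral_fst[symmetric]) (auto simp: case_prod_beta)
  also have "\<dots> = (\<integral>\<^sup>+x. (\<Sum>b\<in>V. ennreal (dens b x)) * indicator B x \<partial>lborel)"
  proof (intro nn_integral_cong)
    fix x
    have "(\<integral>\<^sup>+b. ennreal (dens b x) * indicator (B \<times> V) (x, b) \<partial>count_space UNIV) =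
        (\<Sum>b\<in>UNIV. ennreal (dens b x) * indicator (B \<times> V) (x, b))"
      by (rule nn_integral_count_space_finite) simp
    also have "\<dots> = (\<Sum>b\<in>V. ennreal (dens b x) * indicator B x)"
      by (rule sum.mono_neutral_cong_right) (auto simp: indicator_def)
    finally show "(\<integral>\<^sup>+b. ennreal (dens b x) * indicator (B \<times> V) (x, b) \<partial>count_space UNIV) =
        (\<Sum>b\<in>V. ennreal (dens b x)) * indicator B x"
      by (simp add: sum_distrib_right)
  qed
  finally show ?thesis .
qed

lemma measure_M_label:
  assumes [measurable]: "B \<in> sets borel"
  shows "measure M (B \<times> {b}) = (LINT x:B|lborel. dens b x)"
proof -
  have "emeasure M (B \<times> {b}) = (\<integral>\<^sup>+x. ennreal (indicator B x * dens b x) \<partial>lborel)"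
    using dens_nonneg by (auto simp: emeasure_M indicator_def intro!: nn_integral_cong)
  also have "\<dots> = ennreal (LINT x:B|lborel. dens b x)"
    unfolding set_lebesgue_integral_def using dens_nonneg dens_integrable
    by (subst nn_integral_eq_integral) (auto intro!: integrable_mult_indicator[where 'b = real, simplified])
  finally show ?thesis
    using dens_nonneg unfolding measure_def
    by (simp add: set_lebesgue_integral_def integral_nonneg_AE)
qed

lemma emeasure_M_all:
  assumes [measurable]: "B \<in> sets borel"
  shows "emeasure M (B \<times> UNIV) = ennreal (LINT x:B \<inter> Xs|lborel. p x)"
proof -
  have int: "integrable lborel (\<lambda>x. indicator (B \<inter> Xs) x * p x)"
    using set_integrable_subset[OF p_integrable, of "B \<inter> Xs"] by (simp add: set_integrable_def)
  have "emeasure M (B \<times> UNIV) = (\<integral>\<^sup>+x. ennreal (indicator (B \<inter> Xs) x * p x) \<partial>lborel)"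
    unfolding emeasure_M[OF assms]
  proof (intro nn_integral_cong)
    fix x
    have "(\<Sum>b\<in>UNIV. ennreal (dens b x)) = ennreal (dens True x + dens False x)"
      using dens_nonneg by (simp add: UNIV_bool ennreal_plus add.commute)
    thus "(\<Sum>b\<in>UNIV. ennreal (dens b x)) * indicator B x = ennreal (indicator (B \<inter> Xs) x * p x)"
      by (simp add: dens_sum indicator_def)
  qed
  also have "\<dots> = ennreal (LINT x:B \<inter> Xs|lborel. p x)"
    unfolding set_lebesgue_integral_def using int p_nonneg
    by (subst nn_integral_eq_integral) auto
  finally show ?thesis .
qed

lemma prob_space_M: "prob_space M"
proof
  show "emeasure M (space M) = 1"
    using emeasure_M_all[of UNIV] p_total by (simp add: space_M)
qed

sublocale M: prob_space M
  by (rule prob_space_M)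

section \<open>The mass of a ball as a continuous function of its radius\<close>

definition mass :: "'a set \<Rightarrow> real" where
  "mass B = measure M (B \<times> UNIV)"

text \<open>The bridge between the integral \<open>Pdist\<close> and the marginal
  \<open>mass\<close>, to which the calculus of finite measures applies directly.\<close>

lemma mass_eq_Pdist: "B \<in> sets borel \<Longrightarrow> mass B = Pdist Xs p B"
  unfolding mass_def measure_def Pdist_def
  by (simp add: emeasure_M_all set_lebesgue_integral_def p_nonneg integral_nonneg_AE)

lemma mass_mono: "A \<subseteq> B \<Longrightarrow> B \<in> sets borel \<Longrightarrow> mass A \<le> mass B"
  unfolding mass_def by (intro M.finite_measure_mono) auto

lemma mass_Diff:
  "A \<in> sets borel \<Longrightarrow> B \<in> sets borel \<Longrightarrow> A \<subseteq> B \<Longrightarrow> mass (B - A) = mass B - mass A"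
  unfolding mass_def by (subst M.finite_measure_Diff[symmetric]) (auto simp: Sigma_Diff_distrib1)

lemma mass_split: "B \<in> sets borel \<Longrightarrow> mass B = measure M (B \<times> {b}) + measure M (B \<times> {\<not> b})"
  unfolding mass_def by (subst M.finite_measure_Union[symmetric]) (auto intro!: arg_cong[where f = "measure M"])

text \<open>The position has a density and spheres are Lebesgue null. Hence the mass of a ball has
  no jumps as the radius grows, which makes balls of mass exactly \<open>\<beta>\<close> available
  and ties rare.\<close>

lemma mass_sphere: "mass (sphere x r) = 0"
proof -
  have "sphere x r \<in> null_sets lborel"
    using negligible_sphere[of x r] by (simp add: negligible_iff_null_sets null_sets_completion_iff)
  hence "AE y in lborel. (\<Sum>b\<in>UNIV. ennreal (dens b y)) * indicator (sphere x r) y = 0"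
    by (auto dest!: AE_not_in elim!: eventually_mono)
  hence "(\<integral>\<^sup>+y. (\<Sum>b\<in>UNIV. ennreal (dens b y)) * indicator (sphere x r) y \<partial>lborel) = (\<integral>\<^sup>+(y::'a). 0 \<partial>lborel)"
    by (rule nn_integral_cong_AE)
  hence "emeasure M (sphere x r \<times> UNIV) = 0"
    by (subst emeasure_M) auto
  thus ?thesis by (simp add: mass_def measure_def)
qed

lemma mass_cball_eq_ball: "mass (cball x r) = mass (ball x r)"
proof -
  have "cball x r - ball x r = sphere x r" by auto
  thus ?thesis
    using mass_Diff[of "ball x r" "cball x r"] mass_sphere[of x r] by auto
qed

lemma mass_cball_right_limit: "(\<lambda>j. mass (cball x (r + 1 / Suc j))) \<longlonglongrightarrow> mass (cball x r)"
proof -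
  have "(\<lambda>j. measure M (cball x (r + 1 / Suc j) \<times> UNIV)) \<longlonglongrightarrow>
      measure M (\<Inter>j. cball x (r + 1 / Suc j) \<times> UNIV)"
  proof (rule M.finite_Lim_measure_decseq)
    show "decseq (\<lambda>j. cball x (r + 1 / Suc j) \<times> (UNIV :: bool set))"
      by (intro decseq_SucI Sigma_mono subset_cball order_refl) (simp add: frac_le)
  qed auto
  moreover have "(\<Inter>j. cball x (r + 1 / Suc j) \<times> UNIV) = cball x r \<times> (UNIV :: bool set)"
  proof safe
    fix y b assume "(y, b) \<in> (\<Inter>j. cball x (r + 1 / Suc j) \<times> UNIV)"
    hence "dist x y \<le> r + 1 / Suc j" for j by auto
    moreover have "(\<lambda>j. r + 1 / Suc j) \<longlonglongrightarrow> r + 0"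
      by (intro tendsto_intros LIMSEQ_Suc lim_1_over_n)
    ultimately show "y \<in> cball x r" by (auto intro: LIMSEQ_le_const)
  qed (auto intro: order_trans)
  ultimately show ?thesis by (simp add: mass_def)
qed

text \<open>Closed balls of smaller radius exhaust only the open ball; the missing sphere has mass
  zero.\<close>

lemma mass_cball_left_limit: "(\<lambda>j. mass (cball x (r - 1 / Suc j))) \<longlonglongrightarrow> mass (cball x r)"
proof -
  have "(\<lambda>j. measure M (cball x (r - 1 / Suc j) \<times> UNIV)) \<longlonglongrightarrow>
      measure M (\<Union>j. cball x (r - 1 / Suc j) \<times> UNIV)"
  proof (rule M.finite_Lim_measure_incseq)
    show "incseq (\<lambda>j. cball x (r - 1 / Suc j) \<times> (UNIV :: bool set))"
      by (intro incseq_SucI Sigma_mono subset_cball order_refl) (simp add: frac_le)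
  qed auto
  moreover have "(\<Union>j. cball x (r - 1 / Suc j) \<times> UNIV) = ball x r \<times> (UNIV :: bool set)"
  proof safe
    fix y :: 'a and b :: bool assume "y \<in> ball x r"
    then obtain j where "1 / Suc j < r - dist x y"
      using nat_approx_posE[of "r - dist x y"] by auto
    thus "(y, b) \<in> (\<Union>j. cball x (r - 1 / Suc j) \<times> UNIV)"
      by (auto intro!: exI[of _ j])
  qed (auto intro: le_less_trans)
  ultimately show ?thesis by (simp add: mass_def[symmetric] mass_cball_eq_ball)
qed

lemma Bx_eq: "Bx Xs x r = cball x r \<inter> Xs"
  by (auto simp: Bx_def)

lemma Pdist_Bx: "Pdist Xs p (Bx Xs x r) = mass (cball x r)"
  by (simp add: Bx_eq mass_eq_Pdist) (simp add: Pdist_def)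

text \<open>Radii slightly above the infimum have mass at least \<open>\<beta>\<close> and radii
  slightly below it at most \<open>\<beta>\<close>; the two one-sided limits turn this into equality
  at the infimum.\<close>

lemma mass_beta_ball:
  assumes "0 < \<beta>" "\<beta> < 1"
  shows "mass (cball x (beta_radius Xs p \<beta> x)) = \<beta>"
proof (rule antisym)
  define R where "R = {r. r > 0 \<and> mass (cball x r) \<ge> \<beta>}"
  have rad: "beta_radius Xs p \<beta> x = Inf R"
    by (simp add: beta_radius_def R_def Pdist_Bx)
  obtain e where e: "e > 0" "Xs \<subseteq> cball x e"
  proof -
    obtain e where "\<forall>y\<in>Xs. dist x y \<le> e"
      using compact_imp_bounded[OF compact_Xs] bounded_any_center by blast
    \<comment> \<open>The maximum with \<open>1\<close> makes the radius positive, as membership in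
      \<open>R\<close> demands.\<close>
    thus ?thesis by (intro that[of "max e 1"]) (auto simp: max_def)
  qed
  have "mass (cball x e) = 1"
    using p_total e by (simp add: mass_eq_Pdist Pdist_def Int_absorb1)
  hence ne: "e \<in> R" using e assms by (simp add: R_def)
  have bdd: "bdd_below R" by (auto simp: R_def intro!: bdd_belowI[of _ 0])
  show "\<beta> \<le> mass (cball x (beta_radius Xs p \<beta> x))"
  proof (rule LIMSEQ_le_const[OF mass_cball_right_limit])
    have "\<beta> \<le> mass (cball x (Inf R + 1 / Suc j))" for j
    proof -
      obtain r where r: "r \<in> R" "r < Inf R + 1 / Suc j"
        using cInf_lessD[of R "Inf R + 1 / Suc j"] ne by auto
      hence "mass (cball x r) \<le> mass (cball x (Inf R + 1 / Suc j))"
        by (intro mass_mono) auto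
      thus ?thesis using r by (auto simp: R_def)
    qed
    thus "\<exists>N. \<forall>j\<ge>N. \<beta> \<le> mass (cball x (beta_radius Xs p \<beta> x + 1 / Suc j))"
      by (simp add: rad)
  qed
  show "mass (cball x (beta_radius Xs p \<beta> x)) \<le> \<beta>"
  proof (rule LIMSEQ_le_const2[OF mass_cball_left_limit])
    have "mass (cball x (Inf R - 1 / Suc j)) \<le> \<beta>" for j
    proof (cases "Inf R - 1 / Suc j > 0")
      case True
      have "Inf R - 1 / Suc j \<notin> R"
      proof
        assume "Inf R - 1 / Suc j \<in> R"
        from cInf_lower[OF this bdd] show False by (simp add: field_simps)
      qed
      thus ?thesis using True by (auto simp: R_def)
    next
      case False
      \<comment> \<open>Nonpositive radii lie outside \<open>R\<close> by definition, which says
        nothing about their mass; but such a ball is at most a single point and hence null.\<close>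
      have "cball x (Inf R - 1 / Suc j) \<subseteq> sphere x 0"
      proof
        fix y assume "y \<in> cball x (Inf R - 1 / Suc j)"
        hence "dist x y \<le> 0" using False by (simp only: mem_cball)
        thus "y \<in> sphere x 0" using zero_le_dist[of x y] by (simp only: mem_sphere)
      qed
      hence "mass (cball x (Inf R - 1 / Suc j)) \<le> mass (sphere x 0)"
        by (rule mass_mono) auto
      thus ?thesis using assms by (simp only: mass_sphere)
    qed
    thus "\<exists>N. \<forall>j\<ge>N. mass (cball x (beta_radius Xs p \<beta> x - 1 / Suc j)) \<le> \<beta>"
      by (simp add: rad)
  qed
qed

lemma smoothed_label_eq:
  "smoothed_label Xs p eta \<beta> x = measure M (cball x (beta_radius Xs p \<beta> x) \<times> {True}) / \<beta>"
  unfolding smoothed_label_def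
  by (simp add: measure_M_label set_lebesgue_integral_def Bx_eq dens_def indicator_inter_arith mult_ac)

end

subsection \<open>From counts in balls to nearest neighbours\<close>

text \<open>Balls with rational radii around a countable dense set of centres: one of them fits
  between any two concentric balls of different radii. Uniform statements over all balls thus reduce
  to a countable family.\<close>

lemma countable_ball_family:
  obtains R :: "'a::euclidean_space set set"
  where "countable R" "\<And>B. B \<in> R \<Longrightarrow> \<exists>c r. B = cball c r"
    "\<And>x r r'. r < r' \<Longrightarrow> \<exists>B\<in>R. cball x r \<subseteq> B \<and> B \<subseteq> ball x r'"
proof -
  obtain D :: "'a set" where D: "countable D" "\<And>X. open X \<Longrightarrow> X \<noteq> {} \<Longrightarrow> \<exists>d\<in>D. d \<in> X"
    using countable_dense_setE by blast
  define R where "R = (\<lambda>(c, q). cball c q) ` (D \<times> \<rat>)"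
  show ?thesis
  proof (rule that[of R])
    show "countable R" unfolding R_def using D(1) by (intro countable_image countable_SIGMA countable_rat)
    fix x :: 'a and r r' :: real assume rr: "r < r'"
    \<comment> \<open>Moving the centre by less than \<open>e\<close> costs at most \<open>e\<close>
      at either end, which leaves an interval of radii of length \<open>2 * e\<close>.\<close>
    define e where "e = (r' - r) / 4"
    have e: "e > 0" "r + e < r' - e" using rr by (auto simp: e_def field_simps)
    obtain c where c: "c \<in> D" "dist x c < e"
      using D(2)[of "ball x e"] e by auto
    obtain q where q: "q \<in> \<rat>" "r + e < q" "q < r' - e"
      using Rats_dense_in_real[OF e(2)] by auto
    have "cball x r \<subseteq> cball c q"
    proof
      fix y assume "y \<in> cball x r"
      thus "y \<in> cball c q" using c(2) q(2) dist_triangle[of c y x] by (simp add: dist_commute)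
    qed
    moreover have "cball c q \<subseteq> ball x r'"
    proof
      fix y assume "y \<in> cball c q"
      thus "y \<in> ball x r'" using c(2) q(3) dist_triangle[of x y c] by simp
    qed
    moreover have "cball c q \<in> R"
      unfolding R_def using c(1) q(1) by (intro image_eqI[of _ _ "(c, q)"]) auto
    ultimately show "\<exists>B\<in>R. cball x r \<subseteq> B \<and> B \<subseteq> ball x r'"
      by blast
  qed (auto simp: R_def)
qed

text \<open>The number of distances up to \<open>r\<close> is a right-continuous step function of
  \<open>r\<close>, so the infimum is attained and every smaller radius catches fewer than
  \<open>k\<close> points.\<close>

lemma Inf_card_le:
  fixes d :: "nat \<Rightarrow> real"
  assumes "1 \<le> k" "k \<le> n" and d: "\<And>i. 0 \<le> d i"
  defines "\<rho> \<equiv> Inf {r. k \<le> card {i \<in> {..<n}. d i \<le> r}}"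
  shows "k \<le> card {i \<in> {..<n}. d i \<le> \<rho>}" and "card {i \<in> {..<n}. d i < \<rho>} < k"
proof -
  let ?R = "{r. k \<le> card {i \<in> {..<n}. d i \<le> r}}"
  have bdd: "bdd_below ?R"
  proof (rule bdd_belowI[of _ 0], rule ccontr)
    fix r assume "r \<in> ?R" "\<not> 0 \<le> r"
    hence "{i \<in> {..<n}. d i \<le> r} = {}" using d by (smt (verit) Collect_empty_eq)
    hence "card {i \<in> {..<n}. d i \<le> r} = 0" by (simp only: card.empty)
    moreover have "k \<le> card {i \<in> {..<n}. d i \<le> r}" using \<open>r \<in> ?R\<close> by (rule CollectD)
    ultimately show False using assms(1) by linarith
  qed
  have "{i \<in> {..<n}. d i \<le> Max (d ` {..<n})} = {..<n}" by auto
  hence "card {i \<in> {..<n}. d i \<le> Max (d ` {..<n})} = n" by (simp only: card_lessThan)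
  hence "Max (d ` {..<n}) \<in> ?R" using assms(2) by (simp only: mem_Collect_eq)
  hence ne: "?R \<noteq> {}" by (rule ex_in_conv[THEN iffD1, OF exI])
  show "k \<le> card {i \<in> {..<n}. d i \<le> \<rho>}"
  proof -
    \<comment> \<open>Only finitely many distances exceed \<open>\<rho>\<close>, so there is a gap
      \<open>(\<rho>, t)\<close> without any.\<close>
    define F where "F = d ` {i \<in> {..<n}. \<rho> < d i}"
    have "\<exists>t>\<rho>. \<forall>y\<in>F. t \<le> y"
    proof (cases "F = {}")
      case True
      thus ?thesis by (auto intro!: exI[of _ "\<rho> + 1"])
    next
      case False
      moreover have "finite F" by (simp add: F_def)
      ultimately show ?thesis
        by (intro exI[of _ "Min F"]) (auto simp: F_def)
    qed
    then obtain t where t: "\<rho> < t" "\<And>i. i < n \<Longrightarrow> \<rho> < d i \<Longrightarrow> t \<le> d i"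
      by (auto simp: F_def)
    obtain r where r: "k \<le> card {i \<in> {..<n}. d i \<le> r}" "r < t"
      using cInf_lessD[OF ne, of t] t(1) by (auto simp: \<rho>_def)
    have "{i \<in> {..<n}. d i \<le> r} \<subseteq> {i \<in> {..<n}. d i \<le> \<rho>}"
      using t(2) r(2) by force
    hence "card {i \<in> {..<n}. d i \<le> r} \<le> card {i \<in> {..<n}. d i \<le> \<rho>}"
      by (intro card_mono) auto
    thus ?thesis using r(1) by linarith
  qed
  show "card {i \<in> {..<n}. d i < \<rho>} < k"
  proof (rule ccontr)
    let ?F = "{i \<in> {..<n}. d i < \<rho>}"
    assume F: "\<not> card ?F < k"
    hence "?F \<noteq> {}" using assms(1) by (metis card.empty less_one linorder_not_le order_less_le_trans)
    define t where "t = Max (d ` ?F)"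
    have "t \<in> d ` ?F" unfolding t_def using \<open>?F \<noteq> {}\<close> by (intro Max_in) auto
    hence "t < \<rho>" by auto
    have "?F \<subseteq> {i \<in> {..<n}. d i \<le> t}" by (auto simp: t_def)
    hence "card ?F \<le> card {i \<in> {..<n}. d i \<le> t}" by (intro card_mono) auto
    hence "t \<in> ?R" using F by simp
    from cInf_lower[OF this bdd] show False using \<open>t < \<rho>\<close> by (simp add: \<rho>_def)
  qed
qed

section \<open>Label counts in the nearest-neighbour ball\<close>

context label_model
begin

text \<open>Right continuity of the mass leaves room for a member of \<open>R\<close> around the
  ball at an arbitrarily small cost in mass.\<close>

lemma outer_approximation:
  assumes R: "\<And>x r r'. r < r' \<Longrightarrow> \<exists>B\<in>R. cball x r \<subseteq> B \<and> B \<subseteq> ball x r'" and "0 < \<epsilon>"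
  shows "\<exists>B\<in>R. cball x r \<subseteq> B \<and> mass B < mass (cball x r) + \<epsilon>"
proof -
  have "eventually (\<lambda>j. mass (cball x (r + 1 / Suc j)) < mass (cball x r) + \<epsilon>) sequentially"
    using assms(2) by (intro order_tendstoD(2)[OF mass_cball_right_limit]) auto
  then obtain j where j: "mass (cball x (r + 1 / Suc j)) < mass (cball x r) + \<epsilon>"
    by (auto simp: eventually_sequentially)
  obtain B where B: "B \<in> R" "cball x r \<subseteq> B" "B \<subseteq> ball x (r + 1 / Suc j)"
    using R[of r "r + 1 / Suc j" x] by auto
  hence "mass B \<le> mass (cball x (r + 1 / Suc j))"
    by (intro mass_mono) auto
  thus ?thesis using B j by (intro bexI[of _ B]) auto
qed

lemma inner_approximation:
  assumes R: "\<And>B. B \<in> R \<Longrightarrow> \<exists>c r. B = cball c r"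
    "\<And>x r r'. r < r' \<Longrightarrow> \<exists>B\<in>R. cball x r \<subseteq> B \<and> B \<subseteq> ball x r'" and "0 < \<epsilon>"
  shows "\<exists>B\<in>R. B \<subseteq> ball x r \<and> mass (cball x r) - \<epsilon> < mass B"
proof -
  have "eventually (\<lambda>j. mass (cball x r) - \<epsilon> < mass (cball x (r - 1 / Suc j))) sequentially"
    using assms(3) by (intro order_tendstoD(1)[OF mass_cball_left_limit]) auto
  then obtain j where j: "mass (cball x r) - \<epsilon> < mass (cball x (r - 1 / Suc j))"
    by (auto simp: eventually_sequentially)
  obtain B where B: "B \<in> R" "cball x (r - 1 / Suc j) \<subseteq> B" "B \<subseteq> ball x r"
    using R(2)[of "r - 1 / Suc j" r x] by auto
  moreover have "B \<in> sets borel" using R(1)[OF B(1)] by auto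
  ultimately have "mass (cball x (r - 1 / Suc j)) \<le> mass B"
    by (intro mass_mono) auto
  thus ?thesis using B j by (intro bexI[of _ B]) auto
qed

text \<open>The mass that one label gains in passing from \<open>A\<close> to \<open>B\<close> is at
  most the total gain, since the other label does not lose any.\<close>

lemma label_mass_le:
  assumes "A \<subseteq> B" "A \<in> sets borel" "B \<in> sets borel"
  shows "measure M (B \<times> {b}) \<le> measure M (A \<times> {b}) + (mass B - mass A)"
proof -
  have "measure M (A \<times> {\<not> b}) \<le> measure M (B \<times> {\<not> b})"
    using assms by (intro M.finite_measure_mono) auto
  thus ?thesis using mass_split[of A b] mass_split[of B b] assms by simp
qed

text \<open>A one-sided bound for either label, from which \<open>knn_label_deviation\<close> gets
  both sides. Balls are replaced by members of \<open>R\<close> whose mass differs by less than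
  \<open>1 / n\<close>; this explains the slack \<open>1\<close> in \<open>dev1\<close>, and the
  bound \<open>1\<close> in \<open>dev2\<close> allows shells of mass up to \<open>1 / n\<close>.
  One unit of the \<open>2\<close> in the error pays for the replacement of the
  \<open>\<beta>\<close>-ball, the other for the rounding of \<open>k\<close> or for the
  shell.\<close>

lemma label_fraction_le:
  fixes n :: nat and T\<^sub>1 T\<^sub>2 \<beta> :: real and x :: 'a
  assumes R: "\<And>B. B \<in> R \<Longrightarrow> \<exists>c r. B = cball c r"
    "\<And>x r r'. r < r' \<Longrightarrow> \<exists>B\<in>R. cball x r \<subseteq> B \<and> B \<subseteq> ball x r'"
    and \<beta>: "0 < \<beta>" "\<beta> < 1" "1 < \<beta> * n" and T: "0 \<le> T\<^sub>1" "0 \<le> T\<^sub>2"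
    and dev1: "\<And>B b. B \<in> R \<Longrightarrow> n * measure M (B \<times> {b}) \<le> \<beta> * n + 1 \<Longrightarrow>
      \<bar>hits {..<n} S (B \<times> {b}) - n * measure M (B \<times> {b})\<bar> \<le> T\<^sub>1"
    and dev2: "\<And>B B'. B \<in> R \<Longrightarrow> B' \<in> R \<Longrightarrow> n * mass (B - B') \<le> 1 \<Longrightarrow>
      \<bar>hits {..<n} S ((B - B') \<times> UNIV) - n * mass (B - B')\<bar> \<le> T\<^sub>2"
    and S: "\<And>i. i < n \<Longrightarrow> fst (S i) \<in> Xs"
  defines "N \<equiv> knn_set n Xs S (nat \<lfloor>\<beta> * n\<rfloor>) x"
  shows "0 < card N" and "card {i \<in> N. snd (S i) = b} \<le>
    (measure M (cball x (beta_radius Xs p \<beta> x) \<times> {b}) / \<beta> + (2 + T\<^sub>1 + T\<^sub>2) / (\<beta> * n - 1)) * card N"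
proof -
  define k where "k = nat \<lfloor>\<beta> * n\<rfloor>"
  define d where "d = (\<lambda>i. dist x (fst (S i)))"
  define \<rho> where "\<rho> = Inf {r. k \<le> card {i \<in> {..<n}. d i \<le> r}}"
  define rb where "rb = beta_radius Xs p \<beta> x"
  define q where "q = measure M (cball x rb \<times> {b}) / \<beta>"
  define m where "m = measure M (cball x rb \<times> {b})"
  have n: "n > 0" using \<beta> by (cases n) auto
  have k_real: "real k = real_of_int \<lfloor>\<beta> * n\<rfloor>"
    using \<beta> by (simp add: k_def)
  have k: "real k \<le> \<beta> * n" "\<beta> * n - 1 < real k"
    using k_real by linarith+
  have k1: "1 \<le> k" using \<beta>(3) unfolding k_def by linarith
  have kn: "k \<le> n"
  proof -
    have "\<beta> * n \<le> 1 * real n" using \<beta> by (intro mult_right_mono) auto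
    thus ?thesis using k(1) by simp
  qed
  have Bx_iff: "fst (S i) \<in> Bx Xs x r \<longleftrightarrow> d i \<le> r" if "i < n" for i r
    using S[OF that] by (simp add: Bx_def d_def)
  have sets_eq: "{i \<in> {..<n}. fst (S i) \<in> Bx Xs x r} = {i \<in> {..<n}. d i \<le> r}" for r
    using Bx_iff by blast
  have N: "N = {i \<in> {..<n}. d i \<le> \<rho>}"
    unfolding N_def knn_set_def knn_radius_def sets_eq \<rho>_def k_def[symmetric] by simp
  have card_N: "k \<le> card N" and card_open: "card {i \<in> {..<n}. d i < \<rho>} < k"
    using Inf_card_le[OF k1 kn, of d] by (auto simp: N \<rho>_def d_def)
  have finN: "finite N" by (simp add: N)
  show "0 < card N" using card_N k1 by simp
  have mass_rb: "mass (cball x rb) = \<beta>"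
    unfolding rb_def using \<beta> by (intro mass_beta_ball)
  have m: "0 \<le> m" "m \<le> \<beta>"
    using mass_split[of "cball x rb" b] mass_rb by (auto simp: m_def)
  have q: "0 \<le> q" "q \<le> 1" "q * \<beta> = m"
    using m \<beta> by (auto simp: q_def m_def)
  have borel: "B \<in> sets borel" if "B \<in> R" for B
    using R(1)[OF that] by auto
  define \<epsilon> where "\<epsilon> = (2 + T\<^sub>1 + T\<^sub>2) / (\<beta> * n - 1)"
  have \<epsilon>: "0 \<le> \<epsilon>" "\<epsilon> * (\<beta> * n - 1) = 2 + T\<^sub>1 + T\<^sub>2"
    using \<beta> T by (auto simp: \<epsilon>_def)
  have \<kappa>: "\<beta> * n - 1 \<le> card N" using k card_N by linarith
  \<comment> \<open>Since \<open>card N \<ge> k > \<beta> * n - 1\<close>, an absolute error in the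
    counts becomes the relative error \<open>\<epsilon>\<close>.\<close>
  have \<epsilon>N: "2 + T\<^sub>1 + T\<^sub>2 \<le> \<epsilon> * card N"
    using mult_left_mono[OF \<kappa> \<epsilon>(1)] \<epsilon>(2) by simp
  define c where "c = real (card {i \<in> N. snd (S i) = b})"
  define c' where "c' = real (card {i \<in> N. snd (S i) = (\<not> b)})"
  have "card N = card {i \<in> N. snd (S i) = b} + card {i \<in> N. snd (S i) = (\<not> b)}"
    using finN by (subst card_Un_disjoint[symmetric]) (auto intro!: arg_cong[where f = card])
  hence cc': "real (card N) = c + c'" by (simp add: c_def c'_def)
  have "c \<le> (q + \<epsilon>) * card N"
  proof (cases "\<rho> \<le> rb")
    case True
    obtain B where B: "B \<in> R" "cball x rb \<subseteq> B" "mass B < mass (cball x rb) + 1 / n"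
      using outer_approximation[OF R(2), of "1 / n" x rb] n by auto
    have mB: "measure M (B \<times> {b}) \<le> m + 1 / n"
      using label_mass_le[OF B(2), of b] borel[OF B(1)] B(3) by (simp add: m_def)
    have nB: "n * measure M (B \<times> {b}) \<le> n * m + 1"
      using mult_left_mono[OF mB, of n] n by (simp add: algebra_simps)
    also have "n * m \<le> \<beta> * n" using mult_left_mono[OF m(2), of n] by (simp add: mult.commute)
    finally have "hits {..<n} S (B \<times> {b}) \<le> n * measure M (B \<times> {b}) + T\<^sub>1"
      using dev1[OF B(1), of b] by linarith
    moreover have "c \<le> hits {..<n} S (B \<times> {b})"
    proof -
      have "{i \<in> N. snd (S i) = b} \<subseteq> {i \<in> {..<n}. S i \<in> B \<times> {b}}"
        using True B(2) by (force simp: N d_def mem_Times_iff)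
      thus ?thesis unfolding c_def hits_eq_card[OF finite_lessThan]
        by (simp only: of_nat_le_iff) (intro card_mono; simp)
    qed
    ultimately have "c \<le> n * m + 1 + T\<^sub>1" using nB by linarith
    also have "n * m = q * (\<beta> * n)" using q(3) by (simp add: mult_ac flip: q(3))
    \<comment> \<open>Lowering \<open>\<beta> * n\<close> to the available lower bound on
      \<open>card N\<close> costs \<open>q \<le> 1\<close>.\<close>
    also have "q * (\<beta> * n) + 1 + T\<^sub>1 \<le> q * (\<beta> * n - 1) + (2 + T\<^sub>1 + T\<^sub>2)"
      using q T by (simp add: algebra_simps)
    also have "\<dots> \<le> q * card N + \<epsilon> * card N"
      using mult_left_mono[OF \<kappa> q(1)] \<epsilon>N by linarith
    finally show ?thesis by (simp add: algebra_simps)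
  next
    case False
    obtain B where B: "B \<in> R" "B \<subseteq> ball x rb" "mass (cball x rb) - 1 / n < mass B"
      using inner_approximation[OF R, of "1 / n" x rb] n by auto
    have Bc: "B \<subseteq> cball x rb" using B(2) ball_subset_cball by blast
    have mB: "measure M (cball x rb \<times> {\<not> b}) - 1 / n \<le> measure M (B \<times> {\<not> b})"
      using label_mass_le[OF Bc, of "\<not> b"] borel[OF B(1)] B(3) by simp
    have m': "measure M (cball x rb \<times> {\<not> b}) = (1 - q) * \<beta>"
      using mass_split[of "cball x rb" b] mass_rb q(3) by (simp add: m_def algebra_simps)
    have "n * ((1 - q) * \<beta> - 1 / n) \<le> n * measure M (B \<times> {\<not> b})"
      using mB m' by (intro mult_left_mono) auto
    hence nB: "(1 - q) * (\<beta> * n) - 1 \<le> n * measure M (B \<times> {\<not> b})"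
      using n by (simp add: algebra_simps)
    have "measure M (B \<times> {\<not> b}) \<le> \<beta>"
      using mass_split[OF borel[OF B(1)], of b] mass_mono[OF Bc borel_closed[OF closed_cball]] mass_rb
        measure_nonneg[of M "B \<times> {b}"] by linarith
    hence "n * measure M (B \<times> {\<not> b}) \<le> \<beta> * n"
      by (subst mult.commute) (rule mult_right_mono, simp_all)
    hence "n * measure M (B \<times> {\<not> b}) - T\<^sub>1 \<le> hits {..<n} S (B \<times> {\<not> b})"
      using dev1[OF B(1), of "\<not> b"] by linarith
    also have "\<dots> \<le> c'"
    proof -
      have "{i \<in> {..<n}. S i \<in> B \<times> {\<not> b}} \<subseteq> {i \<in> N. snd (S i) = (\<not> b)}"
        using False B(2) by (force simp: N d_def mem_Times_iff)
      thus ?thesis unfolding c'_def hits_eq_card[OF finite_lessThan]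
        using finN by (simp only: of_nat_le_iff) (intro card_mono; simp)
    qed
    finally have c': "(1 - q) * (\<beta> * n) - 1 - T\<^sub>1 \<le> c'" using nB by linarith
    text \<open>Ties: the sample points on the sphere of radius \<open>\<rho>\<close> lie in a thin shell.\<close>
    obtain B1 where B1: "B1 \<in> R" "cball x \<rho> \<subseteq> B1" "mass B1 < mass (cball x \<rho>) + 1 / (2 * n)"
      using outer_approximation[OF R(2), of "1 / (2 * n)" x \<rho>] n by auto
    obtain B2 where B2: "B2 \<in> R" "B2 \<subseteq> ball x \<rho>" "mass (cball x \<rho>) - 1 / (2 * n) < mass B2"
      using inner_approximation[OF R, of "1 / (2 * n)" x \<rho>] n by auto
    have "B2 \<subseteq> B1" using B1(2) B2(2) by force
    hence "mass (B1 - B2) < 1 / (2 * n) + 1 / (2 * n)"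
      using mass_Diff[of B2 B1] B1 B2 borel by simp
    hence "mass (B1 - B2) \<le> 1 / n" by simp
    hence shell: "n * mass (B1 - B2) \<le> 1"
      using mult_left_mono[of "mass (B1 - B2)" "1 / n" n] n by simp
    have sh: "hits {..<n} S ((B1 - B2) \<times> UNIV) \<le> 1 + T\<^sub>2"
      using dev2[OF B1(1) B2(1) shell] shell by linarith
    \<comment> \<open>Fewer than \<open>k\<close> points lie strictly inside radius
      \<open>\<rho>\<close>; all others in \<open>N\<close> are at distance exactly
      \<open>\<rho>\<close>, between \<open>B2\<close> and \<open>B1\<close>.\<close>
    have "N \<subseteq> {i \<in> {..<n}. d i < \<rho>} \<union> {i \<in> {..<n}. S i \<in> (B1 - B2) \<times> UNIV}"
    proof
      fix i assume i: "i \<in> N"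
      show "i \<in> {i \<in> {..<n}. d i < \<rho>} \<union> {i \<in> {..<n}. S i \<in> (B1 - B2) \<times> UNIV}"
      proof (cases "d i < \<rho>")
        case False
        hence "fst (S i) \<in> cball x \<rho>" "fst (S i) \<notin> ball x \<rho>" using i by (auto simp: N d_def)
        thus ?thesis using B1(2) B2(2) i by (auto simp: N mem_Times_iff)
      qed (use i in \<open>auto simp: N\<close>)
    qed
    hence "card N \<le> card ({i \<in> {..<n}. d i < \<rho>} \<union> {i \<in> {..<n}. S i \<in> (B1 - B2) \<times> UNIV})"
      by (intro card_mono) auto
    also have "\<dots> \<le> card {i \<in> {..<n}. d i < \<rho>} + card {i \<in> {..<n}. S i \<in> (B1 - B2) \<times> UNIV}"
      by (rule card_Un_le)
    finally have "real (card N) \<le> real (card {i \<in> {..<n}. d i < \<rho>}) + hits {..<n} S ((B1 - B2) \<times> UNIV)"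
      unfolding hits_eq_card[OF finite_lessThan] by linarith
    hence NU: "real (card N) \<le> \<beta> * n + 1 + T\<^sub>2"
      using card_open k(1) sh by linarith
    \<comment> \<open>From \<open>c = card N - c'\<close>, the excess of \<open>c\<close> over
      \<open>q * card N\<close> is at most
      \<open>(1 - q) * (card N - \<beta> * n) + 1 + T\<^sub>1\<close>. The difference can be
      negative, because \<open>k\<close> is rounded down.\<close>
    have "(1 - q) * (card N - \<beta> * n) \<le> 1 * (1 + T\<^sub>2)"
    proof (cases "card N - \<beta> * n \<ge> 0")
      case True
      thus ?thesis using q NU T by (intro mult_mono) auto
    next
      case False
      hence "(1 - q) * (card N - \<beta> * n) \<le> 0" using q by (intro mult_nonneg_nonpos) auto
      thus ?thesis using T by simp
    qed
    thus ?thesis using c' cc' \<epsilon>N by (simp add: algebra_simps)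
  qed
  thus "card {i \<in> N. snd (S i) = b} \<le>
    (measure M (cball x (beta_radius Xs p \<beta> x) \<times> {b}) / \<beta> + (2 + T\<^sub>1 + T\<^sub>2) / (\<beta> * n - 1)) * card N"
    by (simp add: c_def q_def \<epsilon>_def rb_def)
qed

end

subsection \<open>The rate\<close>

text \<open>The threshold \<open>T\<close> of \<open>uniform_deviation\<close> as a function of the
  bound \<open>K\<close> on expected counts and the exponent \<open>L\<close>.\<close>

definition deviation :: "nat \<Rightarrow> real \<Rightarrow> real \<Rightarrow> real" where
  "deviation n K L = sqrt n + 2 * L + 2 * sqrt (L * (K + sqrt n))"

lemma deviation_mono: "0 \<le> K \<Longrightarrow> L \<le> L' \<Longrightarrow> deviation n K L \<le> deviation n K L'"
  unfolding deviation_def by (intro add_mono mult_left_mono real_sqrt_le_mono mult_right_mono) auto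

lemma deviation_nonneg: "0 \<le> K \<Longrightarrow> 0 \<le> L \<Longrightarrow> 0 \<le> deviation n K L"
  unfolding deviation_def by auto

text \<open>The dominant term is \<open>2 * sqrt (a * ln x * \<beta> * x)\<close>. The shells have
  bounded expected counts, so their part, like all remaining terms, is of smaller order than
  \<open>sqrt (x * ln x)\<close>. The constants \<open>c\<^sub>1\<close> and
  \<open>c\<^sub>2\<close>, which will carry the confidence level, vanish in the limit.\<close>

lemma rate_limit:
  fixes a \<beta> c\<^sub>1 c\<^sub>2 :: real
  assumes "0 < a" "0 < \<beta>"
  shows "((\<lambda>x::real. (2 + (sqrt x + 2 * (a * ln x + c\<^sub>1) + 2 * sqrt ((a * ln x + c\<^sub>1) * (\<beta> * x + 1 + sqrt x)))
      + (sqrt x + 2 * (2 * a * ln x + c\<^sub>2) + 2 * sqrt ((2 * a * ln x + c\<^sub>2) * (1 + sqrt x))))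
      / (\<beta> * x - 1) / sqrt (ln x / x)) \<longlongrightarrow> 2 * (a * \<beta>) powr (1 / 2) * inverse \<beta>) at_top"
  using assms by real_asymp

lemma ln_growth_le:
  fixes n d :: nat
  assumes "0 < n" "0 < C"
  shows "ln (C * real ((2 * n + 1) ^ d)) \<le> d * ln n + (d * ln 3 + ln C)"
proof -
  have "ln (real (2 * n + 1)) \<le> ln (3 * real n)"
    using assms by (subst ln_le_cancel_iff) auto
  also have "\<dots> = ln 3 + ln n" using assms by (simp add: ln_mult)
  finally have "d * ln (real (2 * n + 1)) \<le> d * (ln 3 + ln n)"
    by (intro mult_left_mono) auto
  moreover have "ln (C * real ((2 * n + 1) ^ d)) = ln C + d * ln (real (2 * n + 1))"
    using assms by (simp only: of_nat_power ln_mult_pos ln_realpow zero_less_power of_nat_0_less_iff)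
  ultimately show ?thesis by (simp add: algebra_simps)
qed

lemma eventually_rate:
  fixes \<beta> \<delta> :: real and D :: nat
  assumes \<beta>: "0 < \<beta>" and \<delta>: "0 < \<delta>" "\<delta> < 1" and D: "1 \<le> D"
  shows "\<forall>\<^sub>F n in sequentially.
    (2 + deviation n (\<beta> * n + 1) (ln (16 / \<delta> * real ((2 * n + 1) ^ (D + 2))))
       + deviation n 1 (ln (8 / \<delta> * real ((2 * n + 1) ^ (2 * (D + 2)))))) / (\<beta> * n - 1)
    \<le> 3 * sqrt ((2 * ln (4 * real D / \<delta>) + 2 * real D * ln n) / (\<beta> * n))"
proof -
  define a where "a = real (D + 2)"
  define c1 where "c1 = a * ln 3 + ln (16 / \<delta>)"
  define c2 where "c2 = 2 * a * ln 3 + ln (8 / \<delta>)"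
  define F where "F = (\<lambda>x::real. (2 + (sqrt x + 2 * (a * ln x + c1) + 2 * sqrt ((a * ln x + c1) * (\<beta> * x + 1 + sqrt x)))
      + (sqrt x + 2 * (2 * a * ln x + c2) + 2 * sqrt ((2 * a * ln x + c2) * (1 + sqrt x)))))"
  have "2 * (a * \<beta>) powr (1 / 2) * inverse \<beta> < 3 * sqrt (2 * real D / \<beta>)"
  proof -
    have "2 * (a * \<beta>) powr (1 / 2) * inverse \<beta> = sqrt (4 * a / \<beta>)"
    proof -
      have "sqrt (a * \<beta>) * inverse \<beta> = sqrt (a * \<beta> * (inverse \<beta>)\<^sup>2)"
        using \<beta> by (simp add: real_sqrt_mult)
      also have "a * \<beta> * (inverse \<beta>)\<^sup>2 = a / \<beta>"
        using \<beta> by (simp add: power2_eq_square field_simps)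
      finally have "sqrt (a * \<beta>) * inverse \<beta> = sqrt (a / \<beta>)" .
      moreover have "2 * sqrt (a / \<beta>) = sqrt (4 * a / \<beta>)"
        using real_sqrt_mult[of "2\<^sup>2" "a / \<beta>"] by simp
      ultimately show ?thesis
        using \<beta> by (simp add: powr_half_sqrt a_def mult.assoc)
    qed
    \<comment> \<open>\<open>4 * (D + 2) < 18 * D\<close> holds from \<open>D = 1\<close> on. The
      strict gap absorbs the lower order terms for large \<open>n\<close>.\<close>
    also have "\<dots> < sqrt (18 * real D / \<beta>)"
      using \<beta> D by (simp add: a_def divide_strict_right_mono)
    also have "\<dots> = 3 * sqrt (2 * real D / \<beta>)"
      using real_sqrt_mult[of "3\<^sup>2" "2 * real D / \<beta>"] by simp
    finally show ?thesis .
  qed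
  hence "\<forall>\<^sub>F x in at_top. F x / (\<beta> * x - 1) / sqrt (ln x / x) < 3 * sqrt (2 * real D / \<beta>)"
    unfolding F_def using \<beta> D by (intro order_tendstoD(2)[OF rate_limit]) (auto simp: a_def)
  hence "\<forall>\<^sub>F n in sequentially. F (real n) / (\<beta> * n - 1) / sqrt (ln n / n) < 3 * sqrt (2 * real D / \<beta>)"
    by (rule eventually_compose_filterlim[OF _ filterlim_real_sequentially])
  moreover have "\<forall>\<^sub>F n::nat in sequentially. 1 < n"
    by (rule eventually_gt_at_top)
  moreover have "\<forall>\<^sub>F n::nat in sequentially. 1 < \<beta> * n"
    using \<beta> by real_asymp
  ultimately show ?thesis
  proof eventually_elim
    case (elim n)
    let ?L1 = "ln (16 / \<delta> * real ((2 * n + 1) ^ (D + 2)))"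
    let ?L2 = "ln (8 / \<delta> * real ((2 * n + 1) ^ (2 * (D + 2))))"
    have L1: "?L1 \<le> a * ln n + c1"
      using ln_growth_le[of n "16 / \<delta>" "D + 2"] elim \<delta> by (simp only: a_def c1_def) simp
    have L2: "?L2 \<le> 2 * a * ln n + c2"
      using ln_growth_le[of n "8 / \<delta>" "2 * (D + 2)"] elim \<delta> by (simp only: a_def c2_def) simp
    have "2 + deviation n (\<beta> * n + 1) ?L1 + deviation n 1 ?L2 \<le>
        2 + deviation n (\<beta> * n + 1) (a * ln n + c1) + deviation n 1 (2 * a * ln n + c2)"
      using L1 L2 \<beta> by (intro add_mono deviation_mono) auto
    also have "\<dots> = F (real n)"
      by (simp add: F_def deviation_def)
    finally have "(2 + deviation n (\<beta> * n + 1) ?L1 + deviation n 1 ?L2) / (\<beta> * n - 1) \<le> F (real n) / (\<beta> * n - 1)"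
      using elim by (intro divide_right_mono) auto
    also have "\<dots> = F (real n) / (\<beta> * n - 1) / sqrt (ln n / n) * sqrt (ln n / n)"
      using elim by simp
    also have "\<dots> \<le> 3 * sqrt (2 * real D / \<beta>) * sqrt (ln n / n)"
      using elim by (intro mult_right_mono) auto
    also have "\<dots> = 3 * sqrt (2 * real D * ln n / (\<beta> * n))"
      by (simp flip: real_sqrt_mult)
    \<comment> \<open>The \<open>ln n\<close> term alone already dominates the error; the confidence
      term is nonnegative because \<open>4 * D / \<delta> \<ge> 1\<close>.\<close>
    also have "\<dots> \<le> 3 * sqrt ((2 * ln (4 * real D / \<delta>) + 2 * real D * ln n) / (\<beta> * n))"
    proof -
      have "0 \<le> ln (4 * real D / \<delta>)" using D \<delta> by (intro ln_ge_zero) (simp add: field_simps)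
      thus ?thesis using \<beta> by (intro mult_left_mono real_sqrt_le_mono divide_right_mono) auto
    qed
    finally show ?case .
  qed
qed

section \<open>Trace counts for labelled balls and for shells\<close>

lemma labelled_ball_traces_card_le:
  fixes \<omega> :: "nat \<Rightarrow> 'a::euclidean_space \<times> bool"
  assumes "\<And>A. A \<in> C \<Longrightarrow> \<exists>c r b. A = cball c r \<times> {b}"
  shows "card ((\<lambda>A. {i \<in> {..<m}. \<omega> i \<in> A}) ` C) \<le> 2 * (m + 1) ^ (DIM('a) + 2)"
proof -
  define F where "F = range (\<lambda>(c, r). {i \<in> {..<m}. dist c (fst (\<omega> i)) \<le> r})"
  have "F \<subseteq> Pow {..<m}" by (auto simp: F_def)
  hence fin: "finite F" by (rule finite_subset) simp
  \<comment> \<open>A labelled trace is determined by the trace of the ball and the label, so the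
    count at most doubles.\<close>
  have "(\<lambda>A. {i \<in> {..<m}. \<omega> i \<in> A}) ` C \<subseteq> (\<lambda>(T, b). T \<inter> {i. snd (\<omega> i) = b}) ` (F \<times> UNIV)"
  proof (rule image_subsetI)
    fix A assume "A \<in> C"
    then obtain c r b where A: "A = cball c r \<times> {b}" using assms by blast
    have "{i \<in> {..<m}. dist c (fst (\<omega> i)) \<le> r} \<in> F" by (auto simp: F_def)
    moreover have "{i \<in> {..<m}. \<omega> i \<in> A} = {i \<in> {..<m}. dist c (fst (\<omega> i)) \<le> r} \<inter> {i. snd (\<omega> i) = b}"
      by (auto simp: A mem_Times_iff)
    ultimately show "{i \<in> {..<m}. \<omega> i \<in> A} \<in> (\<lambda>(T, b). T \<inter> {i. snd (\<omega> i) = b}) ` (F \<times> UNIV)"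
      by (intro image_eqI[of _ _ "({i \<in> {..<m}. dist c (fst (\<omega> i)) \<le> r}, b)"]) auto
  qed
  hence "card ((\<lambda>A. {i \<in> {..<m}. \<omega> i \<in> A}) ` C) \<le> card (F \<times> (UNIV :: bool set))"
    using fin by (intro surj_card_le) auto
  also have "\<dots> = 2 * card F" by (simp add: card_cartesian_product)
  also have "\<dots> \<le> 2 * (m + 1) ^ (DIM('a) + 2)"
    unfolding F_def by (intro mult_left_mono ball_traces_card_le) simp
  finally show ?thesis .
qed

text \<open>The trace of a shell is a difference of two ball traces, which squares the
  count.\<close>

lemma shell_traces_card_le:
  fixes \<omega> :: "nat \<Rightarrow> 'a::euclidean_space \<times> bool"
  assumes "\<And>A. A \<in> C \<Longrightarrow> \<exists>c r c' r'. A = (cball c r - cball c' r') \<times> UNIV"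
  shows "card ((\<lambda>A. {i \<in> {..<m}. \<omega> i \<in> A}) ` C) \<le> (m + 1) ^ (2 * (DIM('a) + 2))"
proof -
  define t where "t = (\<lambda>c r. {i \<in> {..<m}. dist c (fst (\<omega> i)) \<le> r})"
  define F where "F = range (\<lambda>(c, r). t c r)"
  have "F \<subseteq> Pow {..<m}" by (auto simp: F_def t_def)
  hence fin: "finite F" by (rule finite_subset) simp
  have "(\<lambda>A. {i \<in> {..<m}. \<omega> i \<in> A}) ` C \<subseteq> (\<lambda>(T, T'). T - T') ` (F \<times> F)"
  proof (rule image_subsetI)
    fix A assume "A \<in> C"
    then obtain c r c' r' where A: "A = (cball c r - cball c' r') \<times> UNIV" using assms by blast
    have "t c r \<in> F" "t c' r' \<in> F" by (auto simp: F_def)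
    moreover have "{i \<in> {..<m}. \<omega> i \<in> A} = t c r - t c' r'"
      by (auto simp: A t_def mem_Times_iff)
    ultimately show "{i \<in> {..<m}. \<omega> i \<in> A} \<in> (\<lambda>(T, T'). T - T') ` (F \<times> F)"
      by (intro image_eqI[of _ _ "(t c r, t c' r')"]) auto
  qed
  hence "card ((\<lambda>A. {i \<in> {..<m}. \<omega> i \<in> A}) ` C) \<le> card (F \<times> F)"
    using fin by (intro surj_card_le) auto
  also have "\<dots> = card F * card F" by (simp add: card_cartesian_product)
  also have "\<dots> \<le> (m + 1) ^ (DIM('a) + 2) * (m + 1) ^ (DIM('a) + 2)"
    unfolding F_def t_def by (intro mult_mono ball_traces_card_le) auto
  also have "\<dots> = (m + 1) ^ (2 * (DIM('a) + 2))" by (simp only: mult_2 power_add)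
  finally show ?thesis .
qed

section \<open>From the two deviation bounds to the uniform estimate\<close>

context label_model
begin

text \<open>The two label fractions sum to one, and so do their two targets. Upper bounds for both
  labels therefore imply the lower bounds.\<close>

lemma knn_label_deviation:
  fixes n :: nat and T\<^sub>1 T\<^sub>2 \<beta> :: real and x :: 'a
  assumes R: "\<And>B. B \<in> R \<Longrightarrow> \<exists>c r. B = cball c r"
    "\<And>x r r'. r < r' \<Longrightarrow> \<exists>B\<in>R. cball x r \<subseteq> B \<and> B \<subseteq> ball x r'"
    and \<beta>: "0 < \<beta>" "\<beta> < 1" "1 < \<beta> * n" and T: "0 \<le> T\<^sub>1" "0 \<le> T\<^sub>2"
    and dev1: "\<And>B b. B \<in> R \<Longrightarrow> n * measure M (B \<times> {b}) \<le> \<beta> * n + 1 \<Longrightarrow>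
      \<bar>hits {..<n} S (B \<times> {b}) - n * measure M (B \<times> {b})\<bar> \<le> T\<^sub>1"
    and dev2: "\<And>B B'. B \<in> R \<Longrightarrow> B' \<in> R \<Longrightarrow> n * mass (B - B') \<le> 1 \<Longrightarrow>
      \<bar>hits {..<n} S ((B - B') \<times> UNIV) - n * mass (B - B')\<bar> \<le> T\<^sub>2"
    and S: "\<And>i. i < n \<Longrightarrow> fst (S i) \<in> Xs"
  shows "\<bar>knn_label n Xs S (nat \<lfloor>\<beta> * n\<rfloor>) x - smoothed_label Xs p eta \<beta> x\<bar>
    \<le> (2 + T\<^sub>1 + T\<^sub>2) / (\<beta> * n - 1)"
proof -
  define N where "N = knn_set n Xs S (nat \<lfloor>\<beta> * n\<rfloor>) x"
  define \<epsilon> where "\<epsilon> = (2 + T\<^sub>1 + T\<^sub>2) / (\<beta> * n - 1)"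
  define c where "c = (\<lambda>b. real (card {i \<in> N. snd (S i) = b}))"
  define q where "q = (\<lambda>b. measure M (cball x (beta_radius Xs p \<beta> x) \<times> {b}) / \<beta>)"
  have N: "0 < real (card N)"
    using label_fraction_le(1)[OF R \<beta> T dev1 dev2 S] by (simp add: N_def)
  have le: "c b \<le> (q b + \<epsilon>) * card N" for b
    using label_fraction_le(2)[OF R \<beta> T dev1 dev2 S] by (simp add: N_def c_def q_def \<epsilon>_def)
  have finN: "finite N" using N by (meson card_gt_0_iff of_nat_0_less_iff)
  have "card N = card {i \<in> N. snd (S i) = True} + card {i \<in> N. snd (S i) = False}"
    using finN by (subst card_Un_disjoint[symmetric]) (auto intro!: arg_cong[where f = card])
  hence cc: "c True + c False = card N" by (simp add: c_def)
  have "q True + q False = mass (cball x (beta_radius Xs p \<beta> x)) / \<beta>"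
    using mass_split[of "cball x (beta_radius Xs p \<beta> x)" True] by (simp add: q_def add_divide_distrib)
  hence qq: "q True + q False = 1" using mass_beta_ball[OF \<beta>(1,2)] \<beta> by simp
  have "(\<Sum>i\<in>N. if snd (S i) then 1 else 0 :: real) = c True"
    using finN by (simp add: c_def sum.If_cases Int_def)
  hence lab: "knn_label n Xs S (nat \<lfloor>\<beta> * n\<rfloor>) x = c True / card N"
    by (simp add: knn_label_def N_def)
  have "c True / card N \<le> q True + \<epsilon>" "c False / card N \<le> q False + \<epsilon>"
    using le N by (simp_all add: divide_le_eq)
  moreover have "c True / card N + c False / card N = 1"
    using N cc by (simp add: field_simps)
  moreover have "smoothed_label Xs p eta \<beta> x = q True"
    by (simp add: smoothed_label_eq q_def)
  ultimately show ?thesis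
    unfolding lab \<epsilon>_def[symmetric] using qq by linarith
qed

lemma AE_in_Xs: "AE z in M. fst z \<in> Xs"
proof (rule AE_I')
  show "(- Xs) \<times> UNIV \<in> null_sets M"
    using emeasure_M_all[of "- Xs"] by (intro null_setsI) (auto simp: set_lebesgue_integral_def)
qed auto

end

theorem theorem2:
  fixes \<delta> \<beta> :: real
  assumes "0 < \<delta>" "\<delta> < 1" "0 < \<beta>" "\<beta> < 1"
  shows "\<exists>N::nat. \<forall>n\<ge>N. \<forall>(Xs :: 'a::euclidean_space set) p eta.
    compact Xs \<and>
    p \<in> borel_measurable lborel \<and> (\<forall>x. 0 \<le> p x) \<and>
    set_integrable lborel Xs p \<and> (LINT x:Xs|lborel. p x) = 1 \<and>
    eta \<in> borel_measurable lborel \<and> (\<forall>x\<in>Xs. 0 \<le> eta x \<and> eta x \<le> 1)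
    \<longrightarrow>
    (\<exists>E \<in> sets (sample_space n Xs p eta).
       measure (sample_space n Xs p eta) E \<ge> 1 - \<delta> \<and>
       (\<forall>S\<in>E. \<forall>x\<in>Xs.
          \<bar>knn_label n Xs S (nat \<lfloor>\<beta> * real n\<rfloor>) x - smoothed_label Xs p eta \<beta> x\<bar>
          \<le> 3 * sqrt ((2 * ln (4 * real DIM('a) / \<delta>) + 2 * real DIM('a) * ln (real n))
                      / (\<beta> * real n))))"
proof -
  define g where "g n = (2 * n + 1) ^ (DIM('a) + 2)" for n :: nat
  define h where "h n = (2 * n + 1) ^ (2 * (DIM('a) + 2))" for n :: nat
  \<comment> \<open>Chosen so that each bad event has probability at most
    \<open>\<delta> / 2\<close>: \<open>uniform_deviation\<close> contributes a factor
    \<open>4\<close>, and there are at most \<open>2 * g n\<close> traces of labelled balls and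
    \<open>h n\<close> traces of shells.\<close>
  define L1 where "L1 n = ln (16 / \<delta> * real (g n))" for n
  define L2 where "L2 n = ln (8 / \<delta> * real (h n))" for n
  define T1 where "T1 n = deviation n (\<beta> * n + 1) (L1 n)" for n
  define T2 where "T2 n = deviation n 1 (L2 n)" for n
  have "\<forall>\<^sub>F n in sequentially. (2 + T1 n + T2 n) / (\<beta> * n - 1)
      \<le> 3 * sqrt ((2 * ln (4 * real DIM('a) / \<delta>) + 2 * real DIM('a) * ln n) / (\<beta> * n))"
    unfolding T1_def T2_def L1_def L2_def g_def h_def using assms DIM_positive[where 'a = 'a]
    by (intro eventually_rate) (auto simp: Suc_le_eq)
  moreover have "\<forall>\<^sub>F n::nat in sequentially. 1 < \<beta> * n"
    using assms by real_asymp
  ultimately have "\<forall>\<^sub>F n in sequentially. (2 + T1 n + T2 n) / (\<beta> * n - 1)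
      \<le> 3 * sqrt ((2 * ln (4 * real DIM('a) / \<delta>) + 2 * real DIM('a) * ln n) / (\<beta> * n)) \<and> 1 < \<beta> * n"
    by (rule eventually_conj)
  \<comment> \<open>This threshold depends on \<open>\<beta>\<close>, \<open>\<delta>\<close> and
    the dimension only; it is fixed before \<open>Xs\<close>, \<open>p\<close> and
    \<open>eta\<close>.\<close>
  then obtain N where N: "\<And>n. n \<ge> N \<Longrightarrow> (2 + T1 n + T2 n) / (\<beta> * n - 1)
      \<le> 3 * sqrt ((2 * ln (4 * real DIM('a) / \<delta>) + 2 * real DIM('a) * ln n) / (\<beta> * n)) \<and> 1 < \<beta> * n"
    unfolding eventually_sequentially by blast
  obtain R :: "'a set set" where R: "countable R" "\<And>B. B \<in> R \<Longrightarrow> \<exists>c r. B = cball c r"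
    "\<And>x r r'. r < r' \<Longrightarrow> \<exists>B\<in>R. cball x r \<subseteq> B \<and> B \<subseteq> ball x r'"
    by (rule countable_ball_family) blast
  show ?thesis
  proof (intro exI[of _ N] allI impI, elim conjE)
    fix n :: nat and Xs :: "'a set" and p eta :: "'a \<Rightarrow> real"
    assume n: "N \<le> n" and "compact Xs" "p \<in> borel_measurable lborel" "\<forall>x. 0 \<le> p x"
      "set_integrable lborel Xs p" "(LINT x:Xs|lborel. p x) = 1"
      "eta \<in> borel_measurable lborel" "\<forall>x\<in>Xs. 0 \<le> eta x \<and> eta x \<le> 1"
    then interpret label_model Xs p eta
      by unfold_locales auto
    have \<beta>n: "1 < \<beta> * n" using N[OF n] by simp
    hence n0: "0 < n" by (cases n) auto
    let ?P = "PiM {..<n} (\<lambda>_. M)"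
    interpret P: prob_space ?P
      by (intro prob_space_PiM M.prob_space_axioms)
    have R_borel: "B \<in> sets borel" if "B \<in> R" for B
      using R(2)[OF that] by auto
    \<comment> \<open>Only sets with small expected count are kept, which provides the bounds
      \<open>K = \<beta> * n + 1\<close> here and \<open>K = 1\<close> for the shells in
      \<open>C2\<close>.\<close>
    define C1 where "C1 = {A \<in> (\<lambda>(B, b). B \<times> {b}) ` (R \<times> UNIV). n * M.prob A \<le> \<beta> * n + 1}"
    define C2 where "C2 = {A \<in> (\<lambda>(B, B'). (B - B') \<times> UNIV) ` (R \<times> R). n * M.prob A \<le> 1}"
    have C1: "countable C1" "C1 \<subseteq> sets M" "\<And>A. A \<in> C1 \<Longrightarrow> n * M.prob A \<le> \<beta> * n + 1"
      using R(1) R_borel by (auto simp: C1_def intro!: countable_Collect)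
    have C2: "countable C2" "C2 \<subseteq> sets M" "\<And>A. A \<in> C2 \<Longrightarrow> n * M.prob A \<le> 1"
      using R(1) R_borel by (auto simp: C2_def intro!: countable_Collect)
    have g1: "card ((\<lambda>A. {i \<in> {..<2 * n}. \<omega> i \<in> A}) ` C1) \<le> 2 * g n" for \<omega>
      unfolding g_def
    proof (rule labelled_ball_traces_card_le)
      fix A assume "A \<in> C1"
      then obtain B b where "B \<in> R" "A = B \<times> {b}" by (auto simp: C1_def)
      thus "\<exists>c r b. A = cball c r \<times> {b}" using R(2) by blast
    qed
    have g2: "card ((\<lambda>A. {i \<in> {..<2 * n}. \<omega> i \<in> A}) ` C2) \<le> h n" for \<omega>
      unfolding h_def
    proof (rule shell_traces_card_le)
      fix A assume "A \<in> C2"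
      then obtain B B' where "B \<in> R" "B' \<in> R" "A = (B - B') \<times> UNIV" by (auto simp: C2_def)
      thus "\<exists>c r c' r'. A = (cball c r - cball c' r') \<times> UNIV" using R(2) by metis
    qed
    have pow: "1 \<le> real (g n)" "1 \<le> real (h n)"
      by (simp_all only: g_def h_def one_le_power le_add2 real_of_nat_ge_one_iff)
    have "1 < C / \<delta> * y" if "1 < C" "1 \<le> y" for C y
    proof -
      have "1 < C / \<delta>" using that assms by (simp add: less_divide_eq)
      also have "C / \<delta> \<le> C / \<delta> * y" using that assms mult_left_mono[of 1 y "C / \<delta>"] by simp
      finally show ?thesis .
    qed
    note arg = this[OF _ pow(1), of 16, simplified] this[OF _ pow(2), of 8, simplified]
    have L: "0 < L1 n" "0 < L2 n"
      unfolding L1_def L2_def using arg by auto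
    define Bad1 where "Bad1 = {S \<in> space ?P. \<exists>A\<in>C1. T1 n < \<bar>hits {..<n} S A - n * M.prob A\<bar>}"
    define Bad2 where "Bad2 = {S \<in> space ?P. \<exists>A\<in>C2. T2 n < \<bar>hits {..<n} S A - n * M.prob A\<bar>}"
    note bad1 = M.uniform_deviation[OF C1 n0 g1 L(1), folded deviation_def, folded T1_def, folded Bad1_def]
    note bad2 = M.uniform_deviation[OF C2 n0 g2 L(2), folded deviation_def, folded T2_def, folded Bad2_def]
    have "exp (- L1 n) = \<delta> / (16 * g n)"
      unfolding L1_def exp_minus using arg(1) by (subst exp_ln) (auto simp: field_simps)
    hence p1: "P.prob Bad1 \<le> \<delta> / 2"
      using bad1(2) pow(1) by simp
    have "exp (- L2 n) = \<delta> / (8 * h n)"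
      unfolding L2_def exp_minus using arg(2) by (subst exp_ln) (auto simp: field_simps)
    hence p2: "P.prob Bad2 \<le> \<delta> / 2"
      using bad2(2) pow(2) by simp
    \<comment> \<open>The balls in the nearest-neighbour definitions see only points of
      \<open>Xs\<close>, whereas samples live in the whole space; the restriction to
      \<open>G\<close> loses a null set.\<close>
    define G where "G = (\<Pi>\<^sub>E i\<in>{..<n}. Xs \<times> (UNIV :: bool set))"
    have G: "G \<in> sets ?P" unfolding G_def by (intro sets_PiM_I_finite) auto
    have "AE S in ?P. \<forall>i\<in>{..<n}. fst (S i) \<in> Xs"
      using M.prob_space_axioms AE_in_Xs
      by (intro AE_finite_allI AE_PiM_component[where M = "\<lambda>_. M"]) auto
    hence AE_G: "AE S in ?P. S \<in> G"
      by (rule AE_mp) (auto simp: G_def space_PiM PiE_iff mem_Times_iff)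
    define E where "E = (space ?P - (Bad1 \<union> Bad2)) \<inter> G"
    have E: "E \<in> sets ?P" unfolding E_def using G bad1(1) bad2(1) by auto
    have "P.prob (Bad1 \<union> Bad2) \<le> \<delta>"
      using measure_Un_le[OF bad1(1) bad2(1)] p1 p2 by simp
    hence "1 - \<delta> \<le> P.prob (space ?P - (Bad1 \<union> Bad2))"
      using bad1(1) bad2(1) by (subst P.prob_compl) auto
    also have "\<dots> = P.prob E"
      using AE_G E bad1(1) bad2(1) by (intro P.finite_measure_eq_AE) (auto simp: E_def)
    finally have prob_E: "1 - \<delta> \<le> P.prob E" .
    have T: "0 \<le> T1 n" "0 \<le> T2 n"
      unfolding T1_def T2_def using L assms by (auto intro!: deviation_nonneg)
    have "\<bar>knn_label n Xs S (nat \<lfloor>\<beta> * real n\<rfloor>) x - smoothed_label Xs p eta \<beta> x\<bar>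
        \<le> (2 + T1 n + T2 n) / (\<beta> * n - 1)" if S: "S \<in> E" for S x
    proof (rule knn_label_deviation[OF R(2,3) assms(3,4) \<beta>n T])
      fix B b assume "B \<in> R" "n * M.prob (B \<times> {b}) \<le> \<beta> * n + 1"
      hence "B \<times> {b} \<in> C1" by (force simp: C1_def)
      thus "\<bar>hits {..<n} S (B \<times> {b}) - n * M.prob (B \<times> {b})\<bar> \<le> T1 n"
        using S by (force simp: E_def Bad1_def not_less)
    next
      fix B B' assume "B \<in> R" "B' \<in> R" "n * mass (B - B') \<le> 1"
      hence "(B - B') \<times> UNIV \<in> C2" by (force simp: C2_def mass_def)
      thus "\<bar>hits {..<n} S ((B - B') \<times> UNIV) - n * mass (B - B')\<bar> \<le> T2 n"
        using S unfolding mass_def by (force simp: E_def Bad2_def not_less)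
    next
      fix i assume "i < n"
      thus "fst (S i) \<in> Xs" using S by (auto simp: E_def G_def PiE_iff mem_Times_iff)
    qed
    with N[OF n] have "\<forall>S\<in>E. \<forall>x\<in>Xs.
          \<bar>knn_label n Xs S (nat \<lfloor>\<beta> * real n\<rfloor>) x - smoothed_label Xs p eta \<beta> x\<bar>
          \<le> 3 * sqrt ((2 * ln (4 * real DIM('a) / \<delta>) + 2 * real DIM('a) * ln (real n))
                      / (\<beta> * real n))"
      by (meson order_trans)
    with E prob_E show "\<exists>E \<in> sets (sample_space n Xs p eta).
       measure (sample_space n Xs p eta) E \<ge> 1 - \<delta> \<and>
       (\<forall>S\<in>E. \<forall>x\<in>Xs.
          \<bar>knn_label n Xs S (nat \<lfloor>\<beta> * real n\<rfloor>) x - smoothed_label Xs p eta \<beta> x\<bar>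
          \<le> 3 * sqrt ((2 * ln (4 * real DIM('a) / \<delta>) + 2 * real DIM('a) * ln (real n))
                      / (\<beta> * real n)))"
      unfolding sample_space_def by blast
  qed
qed

end
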